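(* Let $G=(V,E)$ be an unweighted graph with $n$ vertices and $m$ edges, $\epsilon\in(0,1]$, and suppose $m>2\rho n$ where $\rho=\frac{1014\ln n}{0.38\epsilon^2}$. Run the algorithm described in the context, producing sets $X_i,F_i,Y_i$. Let $K$ be the largest index $i$ for which $F_i\neq\emptyset$, let $S=\big(\bigcup_{i=0}^K 2^iF_i\big)\cup 2^KY_K$ and $G_S=(V,S)$. Then $G_S\in(1\pm\epsilon/3)G$ with probability at least $1-4/n$.
   Context: A cut is a partition of $V$ into two nonempty parts; its weight in a weighted graph is the total weight of edges crossing it. For weighted graphs $H,G$ on the same vertex set and $\delta>0$, $H\in(1\pm\delta)G$ means every cut has weight in $H$ between $(1-\delta)$ and $(1+\delta)$ times its weight in $G$. For a set $Z$ of unweighted edges and $c>0$, $cZ$ denotes the edges of $Z$ each with weight $c$. Nagamochi–Ibaraki (NI) forests of a multigraph $H$: edge-disjoint forests $T_1,T_2,\ldots$ partitioning $E(H)$ produced by the Nagamochi–Ibaraki scan-first procedure, where $T_j$ is a maximal spanning forest of $H$ minus $T_1\cup\cdots\cup T_{j-1}$, with the property that for every edge $(u,v)\in T_j$, $u$ and $v$ are $j$-edge-connected in $T_1\cup\cdots\cup T_j$. Contracting an edge set merges endpoints, discards resulting self-loops and keeps parallel edges, each surviving edge identified with its original edge. The relevant part of the algorithm: compute NI forests $T_1,T_2,\ldots$ of $G$; set $X_0=E$, $F_0=\bigcup_{1\le j\le 2\rho}T_j$, $Y_0=X_0\setminus F_0$, $i=0$. Loop: if $|Y_i|\le 2\rho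 n$, stop. Otherwise let $X_{i+1}$ contain each edge of $Y_i$ independently with probability $1/2$; increase $i$ by 1; let $k_i=\rho\cdot2^{i+1}$ and $G_c=(V_c,E_c)=(V,X_i)$; while $|E_c|>2k_i|V_c|$, compute NI forests $T_1,\ldots,T_{k_i+1}$ of $G_c$ and contract all edges of $T_{k_i+1}$ in $G_c$; then set $F_i=E_c$ (as a subset of $X_i$), $Y_i=X_i\setminus F_i$, and repeat the loop. *)

theory Defs
  imports "HOL-Probability.Probability" "HOL-Library.While_Combinator"
begin

definition simple_graph :: "'v set \<Rightarrow> 'v set set \<Rightarrow> bool" where
  "simple_graph V E \<longleftrightarrow> finite V \<and> E \<subseteq> {e. e \<subseteq> V \<and> card e = 2}"

definition crosses :: "'a set \<Rightarrow> 'a set \<Rightarrow> bool" where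
  "crosses A e \<longleftrightarrow> e \<inter> A \<noteq> {} \<and> e - A \<noteq> {}"

text \<open>A weighted graph on V is given by its weight function on the two-element subsets of V;
  pairs that are not edges have weight 0.\<close>

type_synonym 'v weighting = "'v set \<Rightarrow> real"

definition scaled :: "real \<Rightarrow> 'v set set \<Rightarrow> 'v weighting" where
  "scaled c Z = (\<lambda>e. if e \<in> Z then c else 0)"

definition cut_weight :: "'v set \<Rightarrow> 'v weighting \<Rightarrow> 'v set \<Rightarrow> real" where
  "cut_weight V w A = (\<Sum>e | e \<subseteq> V \<and> card e = 2 \<and> crosses A e. w e)"

definition cut_approx :: "'v set \<Rightarrow> real \<Rightarrow> 'v weighting \<Rightarrow> 'v weighting \<Rightarrow> bool" where
  "cut_approx V \<delta> H G \<longleftrightarrow>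
     (\<forall>A. A \<noteq> {} \<and> A \<subset> V \<longrightarrow>
        (1 - \<delta>) * cut_weight V G A \<le> cut_weight V H A \<and>
        cut_weight V H A \<le> (1 + \<delta>) * cut_weight V G A)"

record ('a, 'e) mgraph =
  mverts :: "'a set"
  medges :: "'e set"
  mends :: "'e \<Rightarrow> 'a set"

definition multigraph :: "('a, 'e) mgraph \<Rightarrow> bool" where
  "multigraph H \<longleftrightarrow> finite (mverts H) \<and> finite (medges H) \<and>
     (\<forall>e\<in>medges H. mends H e \<subseteq> mverts H \<and> card (mends H e) = 2)"

definition connected_in :: "('a, 'e) mgraph \<Rightarrow> 'e set \<Rightarrow> 'a \<Rightarrow> 'a \<Rightarrow> bool" where
  "connected_in H T u v \<longleftrightarrow> (u, v) \<in> {(x, y). \<exists>e\<in>T. mends H e = {x, y}}\<^sup>*"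

definition edge_connected_in :: "('a, 'e) mgraph \<Rightarrow> 'e set \<Rightarrow> nat \<Rightarrow> 'a \<Rightarrow> 'a \<Rightarrow> bool" where
  "edge_connected_in H T j u v \<longleftrightarrow>
     (\<forall>A\<subseteq>mverts H. u \<in> A \<and> v \<notin> A \<longrightarrow> j \<le> card {e\<in>T. crosses A (mends H e)})"

text \<open>Two distinct parallel edges form a cycle (of length 2).\<close>

definition is_cycle :: "('a, 'e) mgraph \<Rightarrow> 'a list \<Rightarrow> 'e list \<Rightarrow> bool" where
  "is_cycle H vs es \<longleftrightarrow> vs \<noteq> [] \<and> length es = length vs \<and> distinct vs \<and> distinct es \<and>
     (\<forall>i<length vs. mends H (es ! i) = {vs ! i, vs ! (Suc i mod length vs)})"

definition forest :: "('a, 'e) mgraph \<Rightarrow> 'e set \<Rightarrow> bool" where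
  "forest H T \<longleftrightarrow> (\<nexists>vs es. is_cycle H vs es \<and> set es \<subseteq> T)"

definition maximal_forest :: "('a, 'e) mgraph \<Rightarrow> 'e set \<Rightarrow> 'e set \<Rightarrow> bool" where
  "maximal_forest H R T \<longleftrightarrow> T \<subseteq> R \<and> forest H T \<and>
     (\<forall>T'. T \<subseteq> T' \<and> T' \<subseteq> R \<and> forest H T' \<longrightarrow> T' = T)"

text \<open>The sequence is indexed from 1; the value at 0 is irrelevant.\<close>

definition NI_forests :: "('a, 'e) mgraph \<Rightarrow> (nat \<Rightarrow> 'e set) \<Rightarrow> bool" where
  "NI_forests H T \<longleftrightarrow>
     (\<Union>j\<in>{1..}. T j) = medges H \<and>
     disjoint_family_on T {1..} \<and>
     (\<forall>j\<ge>1. maximal_forest H (medges H - (\<Union>i\<in>{1..<j}. T i)) (T j)) \<and>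
     (\<forall>j\<ge>1. \<forall>e\<in>T j. \<forall>u v. mends H e = {u, v} \<longrightarrow>
        edge_connected_in H (\<Union>i\<in>{1..j}. T i) j u v)"

text \<open>The vertices of a contracted graph are the sets of original vertices merged so far, so an
  uncontracted graph appears with singletons as vertices. Edges are original edges throughout.\<close>

type_synonym 'v cgraph = "('v set, 'v set) mgraph"

definition uncontracted :: "'v set \<Rightarrow> 'v set set \<Rightarrow> 'v cgraph" where
  "uncontracted V X = \<lparr>mverts = (\<lambda>v. {v}) ` V, medges = X, mends = (\<lambda>e. (\<lambda>v. {v}) ` e)\<rparr>"

definition merged :: "'v cgraph \<Rightarrow> 'v set set \<Rightarrow> 'v set \<Rightarrow> 'v set" where
  "merged H T B = \<Union>{B' \<in> mverts H. connected_in H T B B'}"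

definition contract :: "'v cgraph \<Rightarrow> 'v set set \<Rightarrow> 'v cgraph" where
  "contract H T =
     \<lparr>mverts = merged H T ` mverts H,
      medges = {e \<in> medges H. \<not> is_singleton (merged H T ` mends H e)},
      mends = (\<lambda>e. merged H T ` mends H e)\<rparr>"

type_synonym 'v NI_procedure = "'v cgraph \<Rightarrow> nat \<Rightarrow> 'v set set"

definition NI_procedure :: "'v NI_procedure \<Rightarrow> bool" where
  "NI_procedure NI \<longleftrightarrow> (\<forall>H. multigraph H \<longrightarrow> NI_forests H (NI H))"

definition rho :: "nat \<Rightarrow> real \<Rightarrow> real" where
  "rho n \<epsilon> = 1014 * ln (real n) / (0.38 * \<epsilon>\<^sup>2)"

text \<open>The threshold k is a real number. The forest of index floor(k) + 1 is both the last one of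
  index at most k + 1 and the first one of index greater than k.\<close>

definition contract_heavy :: "'v NI_procedure \<Rightarrow> 'v set \<Rightarrow> real \<Rightarrow> 'v set set \<Rightarrow> 'v cgraph" where
  "contract_heavy NI V k X =
     while (\<lambda>H. real (card (medges H)) > 2 * k * real (card (mverts H)))
           (\<lambda>H. contract H (NI H (nat \<lfloor>k\<rfloor> + 1)))
           (uncontracted V X)"

definition sample_half :: "'e set \<Rightarrow> 'e set pmf" where
  "sample_half Y = map_pmf (\<lambda>\<omega>. {e\<in>Y. \<omega> e}) (Pi_pmf Y False (\<lambda>_. bernoulli_pmf (1/2)))"

text \<open>A run of the algorithm is recorded as the list of the triples (X i, F i, Y i).\<close>

type_synonym 'v run = "('v set set \<times> 'v set set \<times> 'v set set) list"

definition X_of :: "'v run \<Rightarrow> nat \<Rightarrow> 'v set set" where "X_of r i = fst (r ! i)"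
definition F_of :: "'v run \<Rightarrow> nat \<Rightarrow> 'v set set" where "F_of r i = fst (snd (r ! i))"
definition Y_of :: "'v run \<Rightarrow> nat \<Rightarrow> 'v set set" where "Y_of r i = snd (snd (r ! i))"

definition initial_round ::
    "'v NI_procedure \<Rightarrow> 'v set \<Rightarrow> 'v set set \<Rightarrow> real \<Rightarrow> 'v set set \<times> 'v set set \<times> 'v set set" where
  "initial_round NI V E \<rho> =
     (let F = (\<Union>j\<in>{j. 1 \<le> j \<and> real j \<le> 2 * \<rho>}. NI (uncontracted V E) j)
      in (E, F, E - F))"

definition next_round ::
    "'v NI_procedure \<Rightarrow> 'v set \<Rightarrow> real \<Rightarrow> nat \<Rightarrow> 'v set set \<Rightarrow>
       'v set set \<times> 'v set set \<times> 'v set set" where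
  "next_round NI V \<rho> i X =
     (let F = medges (contract_heavy NI V (\<rho> * 2 ^ (i + 1)) X)
      in (X, F, X - F))"

text \<open>In the recursive call the new round has index \<open>length r\<close>. A nonterminating run would only
  contribute missing mass.\<close>

partial_function (spmf) sampling_loop ::
    "'v NI_procedure \<Rightarrow> 'v set \<Rightarrow> real \<Rightarrow> 'v run \<Rightarrow> 'v run spmf" where
  "sampling_loop NI V \<rho> r =
     (if real (card (Y_of r (length r - 1))) \<le> 2 * \<rho> * real (card V) then return_spmf r
      else bind_spmf (spmf_of_pmf (sample_half (Y_of r (length r - 1))))
             (\<lambda>X. sampling_loop NI V \<rho> (r @ [next_round NI V \<rho> (length r) X])))"

definition sampling_algorithm ::
    "'v NI_procedure \<Rightarrow> 'v set \<Rightarrow> 'v set set \<Rightarrow> real \<Rightarrow> 'v run spmf" where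
  "sampling_algorithm NI V E \<rho> = sampling_loop NI V \<rho> [initial_round NI V E \<rho>]"

definition last_index :: "'v run \<Rightarrow> nat" where
  "last_index r = Max {i. i < length r \<and> F_of r i \<noteq> {}}"

text \<open>The F i and Y K are pairwise disjoint, so the union of the weighted edge sets is the sum of
  their weight functions.\<close>

definition sparse_graph :: "'v run \<Rightarrow> 'v weighting" where
  "sparse_graph r =
     (let K = last_index r
      in (\<lambda>e. (\<Sum>i\<le>K. scaled (2 ^ i) (F_of r i) e) + scaled (2 ^ K) (Y_of r K) e))"

end

theory Submission
  imports Defs
begin

text \<open>Every edge of \<open>Y i\<close> joins two vertices that are \<open>k i\<close>-edge-connected in \<open>X i\<close>: contracting an
  edge of the forest of index \<open>floor k + 1\<close> only merges such vertices. Hence a cut of \<open>X i\<close> that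
  contains an edge of \<open>Y i\<close> has some size \<open>s \<ge> k i\<close>. The key fact is that such cuts of size at most
  \<open>s\<close> have at most \<open>(2 n) powr (8 s / k)\<close> distinct traces on \<open>Y i\<close>, whereas by Hoeffding's inequality
  the sampling error for a single trace is too large with probability only about
  \<open>n powr (- 13.5 s / k)\<close>. A union bound over \<open>s\<close>, over traces and over the fewer than \<open>n\<close> rounds shows
  that all rounds are accurate on all cuts, with relative errors that decrease geometrically, and
  these errors telescope to \<open>\<epsilon> / 3\<close>.

  The counting bound replaces splitting-off and random contraction by an averaging argument. A family
  of cuts makes the vertices a metric space, the distance of two vertices being the number of cuts in
  the family that separate them. By ball growing, two of the \<open>t\<close> distinct endpoints of \<open>Y\<close>-edges are
  so close that at most a fraction \<open>4 s / (k t)\<close> of the family separates them. Dropping these cuts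
  identifies the two endpoints, and one proceeds by induction.\<close>

section \<open>Counting the traces of small cuts on heavy edges\<close>

definition cut_edges :: "'a set set \<Rightarrow> 'a set \<Rightarrow> 'a set set" where
  "cut_edges X A = {e \<in> X. crosses A e}"

text \<open>\<open>k\<close>-edge-connectivity in \<open>X\<close> of the ends of every edge of
  \<open>Y\<close>, stated through cut sizes. The threshold is real because it will be a multiple of
  \<open>\<rho>\<close>.\<close>

definition heavy :: "'v set \<Rightarrow> real \<Rightarrow> 'v set set \<Rightarrow> 'v set set \<Rightarrow> bool" where
  "heavy V k X Y \<longleftrightarrow>
     (\<forall>e\<in>Y. \<forall>A\<subseteq>V. crosses A e \<longrightarrow> k \<le> real (card (cut_edges X A)))"

text \<open>Coordinates of the vertex \<open>x\<close> in the Hamming cube over \<open>N\<close>: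
  two traces differ in exactly the cuts that separate the two vertices, and vertices that
  \<open>N\<close> does not separate become one point.\<close>

definition cut_trace :: "'a set set \<Rightarrow> 'a \<Rightarrow> 'a set set" where
  "cut_trace N x = {A \<in> N. x \<in> A}"

text \<open>Traces instead of vertices, so that terminals fuse when cuts are dropped from
  \<open>N\<close>. An edge crossed by no cut in \<open>N\<close> is left out: its two ends have the
  same trace, so no ball separates them.\<close>

definition terminals :: "'a set set \<Rightarrow> 'a set set \<Rightarrow> 'a set set set" where
  "terminals Y N = {cut_trace N x |x. \<exists>e\<in>Y. x \<in> e \<and> (\<exists>A\<in>N. crosses A e)}"

abbreviation sdist :: "'a set \<Rightarrow> 'a set \<Rightarrow> nat" where
  "sdist p q \<equiv> card (sym_diff p q)"

lemma cut_trace_in_terminals: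
  "e \<in> Y \<Longrightarrow> x \<in> e \<Longrightarrow> A \<in> N \<Longrightarrow> crosses A e \<Longrightarrow> cut_trace N x \<in> terminals Y N"
  by (auto simp: terminals_def)

lemma crosses_pair: "crosses A {x, y} \<longleftrightarrow> (x \<in> A) \<noteq> (y \<in> A)"
  unfolding crosses_def by auto

lemma cut_edges_subset: "cut_edges X A \<subseteq> X"
  by (auto simp: cut_edges_def)

lemma sdist_triangle:
  assumes "finite p" "finite q" "finite r"
  shows "sdist p r \<le> sdist p q + sdist q r"
proof -
  have "sdist p r \<le> card (sym_diff p q \<union> sym_diff q r)"
    by (rule card_mono) (use assms in auto)
  also have "\<dots> \<le> sdist p q + sdist q r"
    by (rule card_Un_le)
  finally show ?thesis .
qed

lemma sdist_commute: "sdist p q = sdist q p"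
  by (simp add: Un_commute)

text \<open>Balls of radius below \<open>R\<close> around the points of \<open>P\<close> are
  disjoint, so \<open>a\<close> lies in the balls of at most one centre \<open>p\<close>. The radii
  at which that ball contains \<open>a\<close> but not \<open>b\<close> lie between the distances of
  \<open>p\<close> to \<open>a\<close> and to \<open>b\<close>, and the triangle inequality bounds
  their number.\<close>

lemma ball_boundary_count:
  assumes fin: "finite N" and P: "finite P" "\<And>p. p \<in> P \<Longrightarrow> p \<subseteq> N"
    and ab: "a \<subseteq> N" "b \<subseteq> N"
    and sep: "\<And>p q. p \<in> P \<Longrightarrow> q \<in> P \<Longrightarrow> p \<noteq> q \<Longrightarrow> 2 * R < sdist p q + 2"
  shows "(\<Sum>p\<in>P. card {r. r < R \<and> sdist p a \<le> r \<and> r < sdist p b}) \<le> sdist a b"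
proof (cases "\<exists>p\<in>P. sdist p a < R")
  case False
  then have "{r. r < R \<and> sdist p a \<le> r \<and> r < sdist p b} = {}" if "p \<in> P" for p
    using that by force
  then have "(\<Sum>p\<in>P. card {r. r < R \<and> sdist p a \<le> r \<and> r < sdist p b}) = (\<Sum>p\<in>P. 0)"
    by (intro sum.cong refl) (simp only: card.empty)
  then show ?thesis by simp
next
  case True
  then obtain p where p: "p \<in> P" "sdist p a < R" by blast
  have fin': "finite q" if "q \<subseteq> N" for q using that fin finite_subset by blast
  have empty: "{r. r < R \<and> sdist q a \<le> r \<and> r < sdist q b} = {}" if "q \<in> P - {p}" for q
  proof (rule ccontr)
    assume "\<not> ?thesis"
    then have "sdist q a < R" by auto
    moreover have "sdist p q \<le> sdist p a + sdist a q"
      using that p P ab fin' by (intro sdist_triangle) auto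
    moreover have "sdist a q = sdist q a" by (rule sdist_commute)
    moreover have "2 * R < sdist p q + 2" using sep[of p q] that p by auto
    ultimately show False using p by linarith
  qed
  have "(\<Sum>q\<in>P. card {r. r < R \<and> sdist q a \<le> r \<and> r < sdist q b})
      = card {r. r < R \<and> sdist p a \<le> r \<and> r < sdist p b}"
    using empty p P by (subst sum.remove[of _ p]) auto
  also have "\<dots> \<le> card {sdist p a ..< sdist p b}"
    by (rule card_mono) auto
  also have "\<dots> \<le> sdist a b"
    using sdist_triangle[of p a b] p P ab fin' by simp
  finally show ?thesis .
qed

lemma trace_subset: "cut_trace N x \<subseteq> N"
  by (auto simp: cut_trace_def)

lemma sdist_trace: "sdist (cut_trace N x) (cut_trace N y) = card {A \<in> N. crosses A {x, y}}"
  by (rule arg_cong[where f = card]) (auto simp: cut_trace_def crosses_pair)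

text \<open>If all terminals were pairwise far apart, the disjoint balls around them would have heavy
  boundaries at every radius, which costs more edge length than the cuts in \<open>N\<close> provide.\<close>

lemma close_terminals:
  assumes finV: "finite V" and finX: "finite X"
    and X: "\<And>e. e \<in> X \<Longrightarrow> e \<subseteq> V \<and> card e = 2"
    and YX: "Y \<subseteq> X" and hv: "heavy V k X Y" and k: "k > 0"
    and N: "N \<subseteq> Pow V" "\<And>A. A \<in> N \<Longrightarrow> card (cut_edges X A) \<le> s"
    and two: "card (terminals Y N) \<ge> 2"
  shows "\<exists>p\<in>terminals Y N. \<exists>q\<in>terminals Y N. p \<noteq> q \<and>
           real (card (terminals Y N)) * k * real (sdist p q) \<le> 4 * real (card N) * real s"
proof -
  define T where "T = terminals Y N"
  have finN: "finite N" using N(1) finV by (meson finite_Pow_iff finite_subset)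
  have TN: "p \<subseteq> N" if "p \<in> T" for p
    using that by (auto simp: T_def terminals_def cut_trace_def)
  have finT: "finite T" using TN finN by (meson Pow_iff finite_Pow_iff finite_subset subsetI)
  have card_T: "card T \<ge> 2" using two by (simp add: T_def)
  define D where "D = {sdist p q |p q. p \<in> T \<and> q \<in> T \<and> p \<noteq> q}"
  have "D \<subseteq> (\<lambda>(p, q). sdist p q) ` (T \<times> T)" by (auto simp: D_def)
  then have finD: "finite D" using finT by (meson finite_SigmaI finite_imageI finite_subset)
  obtain p0 q0 where "p0 \<in> T" "q0 \<in> T" "p0 \<noteq> q0"
    using card_T finT by (metis card_le_Suc0_iff_eq not_less_eq_eq numeral_2_eq_2)
  then have D_ne: "D \<noteq> {}" by (auto simp: D_def)
  define L where "L = Min D"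
  have L_in: "L \<in> D" unfolding L_def using finD D_ne by (rule Min_in)
  have L_le: "L \<le> sdist p q" if "p \<in> T" "q \<in> T" "p \<noteq> q" for p q
    unfolding L_def using finD that by (intro Min_le) (auto simp: D_def)
  \<comment> \<open>Half the minimal distance, rounded up: balls of radius at most
    \<open>R - 1\<close> are still disjoint, and the number \<open>R\<close> of available radii is
    at least \<open>L / 2\<close>.\<close>
  define R where "R = (L + 1) div 2"
  have R: "L \<le> 2 * R" "2 * R < L + 2" unfolding R_def by linarith+
  define B where "B p r = {x \<in> V. sdist p (cut_trace N x) \<le> r}" for p r
  \<comment> \<open>A terminal has an edge of \<open>Y\<close> leading to a different terminal,
    which is at distance at least \<open>L > r\<close>. The ball therefore cuts this edge, and
    heaviness applies.\<close>
  have bnd: "k \<le> real (card (cut_edges X (B p r)))" if p: "p \<in> T" and r: "r < R" for p r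
  proof -
    obtain x e A where x: "p = cut_trace N x" "e \<in> Y" "x \<in> e" "A \<in> N" "crosses A e"
      using p by (auto simp: T_def terminals_def)
    then have "card e = 2" "e \<subseteq> V" using YX X by auto
    then obtain y where y: "e = {x, y}" "x \<noteq> y"
      using x(3) by (metis card_2_iff doubleton_eq_iff insertE singletonD)
    have "cut_trace N y \<in> T" using x y cut_trace_in_terminals[of e Y y A N] by (auto simp: T_def)
    moreover have "cut_trace N y \<noteq> p" using x y by (auto simp: crosses_pair cut_trace_def)
    ultimately have "r < sdist p (cut_trace N y)"
      using L_le[OF p] R r by fastforce
    then have "crosses (B p r) e"
      using x y \<open>e \<subseteq> V\<close> by (auto simp: crosses_pair B_def)
    moreover have "B p r \<subseteq> V" by (auto simp: B_def)
    ultimately show ?thesis using hv x(2) by (auto simp: heavy_def)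
  qed
  \<comment> \<open>A ball can contain either end of \<open>e\<close> and miss the other. Each of
    the two orientations contributes at most the distance of the two traces, hence the factor
    2.\<close>
  have edge: "(\<Sum>p\<in>T. \<Sum>r<R. of_bool (crosses (B p r) e)) \<le> 2 * card {A \<in> N. crosses A e}"
    if e: "e \<in> X" for e
  proof -
    obtain x y where xy: "e = {x, y}" "x \<in> V" "y \<in> V"
      using X[OF e] by (metis card_2_iff insert_subset)
    have sep: "2 * R < sdist p q + 2" if "p \<in> T" "q \<in> T" "p \<noteq> q" for p q
      using L_le[OF that] R by linarith
    let ?f = "\<lambda>a b p. {r. r < R \<and> sdist p (cut_trace N a) \<le> r \<and> r < sdist p (cut_trace N b)}"
    have "(\<Sum>p\<in>T. \<Sum>r<R. of_bool (crosses (B p r) e)) = (\<Sum>p\<in>T. card {r. r < R \<and> crosses (B p r) e})"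
      by (intro sum.cong refl) (auto simp: Int_def lessThan_def conj_commute)
    also have "\<dots> \<le> (\<Sum>p\<in>T. card (?f x y p \<union> ?f y x p))"
      by (intro sum_mono card_mono) (auto simp: xy crosses_pair B_def)
    also have "\<dots> \<le> (\<Sum>p\<in>T. card (?f x y p)) + (\<Sum>p\<in>T. card (?f y x p))"
      unfolding sum.distrib[symmetric] by (intro sum_mono card_Un_le)
    also have "\<dots> \<le> sdist (cut_trace N x) (cut_trace N y) + sdist (cut_trace N y) (cut_trace N x)"
      by (intro add_mono ball_boundary_count[OF finN finT] TN sep trace_subset)
    also have "\<dots> = 2 * card {A \<in> N. crosses A e}"
      using sdist_trace[of N x y] sdist_trace[of N y x] by (simp add: xy insert_commute)
    finally show ?thesis .
  qed
  \<comment> \<open>Double counting of the triples of a terminal, a radius and an edge on the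
    boundary of the ball. The lower bound is \<open>bnd\<close>; the upper bound is
    \<open>edge\<close>, regrouped by the cuts of \<open>N\<close>, each with at most
    \<open>s\<close> edges.\<close>
  have "real (card T) * real R * k = (\<Sum>p\<in>T. \<Sum>r<R. k)" by simp
  also have "\<dots> \<le> (\<Sum>p\<in>T. \<Sum>r<R. real (card (cut_edges X (B p r))))"
    by (intro sum_mono bnd) auto
  also have "\<dots> = real (\<Sum>p\<in>T. \<Sum>r<R. \<Sum>e\<in>X. of_bool (crosses (B p r) e))"
    using finX by (simp add: cut_edges_def Int_def)
  also have "(\<Sum>p\<in>T. \<Sum>r<R. \<Sum>e\<in>X. of_bool (crosses (B p r) e))
      = (\<Sum>p\<in>T. \<Sum>e\<in>X. \<Sum>r<R. of_bool (crosses (B p r) e))"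
    by (intro sum.cong refl sum.swap)
  also have "\<dots> = (\<Sum>e\<in>X. \<Sum>p\<in>T. \<Sum>r<R. of_bool (crosses (B p r) e))"
    by (rule sum.swap)
  also have "real \<dots> \<le> real (\<Sum>e\<in>X. 2 * card {A \<in> N. crosses A e})"
    using edge by (intro of_nat_mono sum_mono)
  also have "(\<Sum>e\<in>X. 2 * card {A \<in> N. crosses A e}) = 2 * (\<Sum>e\<in>X. \<Sum>A\<in>N. of_bool (crosses A e))"
    using finN by (simp add: sum_distrib_left Int_def)
  also have "(\<Sum>e\<in>X. \<Sum>A\<in>N. of_bool (crosses A e)) = (\<Sum>A\<in>N. \<Sum>e\<in>X. of_bool (crosses A e) :: nat)"
    by (rule sum.swap)
  also have "\<dots> = (\<Sum>A\<in>N. card (cut_edges X A))"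
    using finX by (simp add: cut_edges_def Int_def)
  also have "real (2 * \<dots>) \<le> real (2 * (card N * s))"
  proof (intro of_nat_mono mult_le_mono2)
    show "(\<Sum>A\<in>N. card (cut_edges X A)) \<le> card N * s"
      using sum_bounded_above[of N "\<lambda>A. card (cut_edges X A)" s] N(2) by simp
  qed
  finally have main: "real (card T) * real R * k \<le> 2 * real (card N) * real s" by simp
  obtain p q where pq: "p \<in> T" "q \<in> T" "p \<noteq> q" "L = sdist p q"
    using L_in by (auto simp: D_def)
  have "real (card T) * k * real L \<le> real (card T) * k * real (2 * R)"
    using R k by (intro mult_left_mono) (auto simp del: of_nat_mult)
  also have "\<dots> \<le> 4 * real (card N) * real s" using main by (simp add: mult_ac)
  finally show ?thesis using pq T_def by blast
qed


text \<open>Traces over the smaller family are restrictions of the old ones, and the restrictions of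
  \<open>p\<close> and \<open>q\<close> coincide once the cuts that separate them are gone.\<close>

lemma terminals_merge:
  assumes fin: "finite N" and p: "p \<in> terminals Y N" and q: "q \<in> terminals Y N" and "p \<noteq> q"
  shows "card (terminals Y (N - sym_diff p q)) < card (terminals Y N)"
proof -
  let ?N' = "N - sym_diff p q" and ?T = "terminals Y N"
  have "?T \<subseteq> Pow N" by (auto simp: terminals_def cut_trace_def)
  then have finT: "finite ?T" using fin by (meson finite_Pow_iff finite_subset)
  have pq: "p \<inter> ?N' = q \<inter> ?N'" by auto
  have tr: "cut_trace ?N' x = cut_trace N x \<inter> ?N'" for x by (auto simp: cut_trace_def)
  have "terminals Y ?N' \<subseteq> (\<lambda>r. r \<inter> ?N') ` ?T"
  proof -
    have "cut_trace ?N' x \<in> (\<lambda>r. r \<inter> ?N') ` ?T" if "e \<in> Y" "x \<in> e" "A \<in> ?N'" "crosses A e" for x e A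
    proof -
      have "cut_trace N x \<in> ?T" using that by (auto simp: terminals_def)
      then show ?thesis using tr by (intro image_eqI) auto
    qed
    then show ?thesis by (subst (1) terminals_def) blast
  qed
  also have "\<dots> \<subseteq> (\<lambda>r. r \<inter> ?N') ` (?T - {q})"
  proof
    fix z assume "z \<in> (\<lambda>r. r \<inter> ?N') ` ?T"
    then obtain r where r: "r \<in> ?T" "z = r \<inter> ?N'" by blast
    show "z \<in> (\<lambda>r. r \<inter> ?N') ` (?T - {q})"
    proof (cases "r = q")
      case True
      then show ?thesis using r pq p \<open>p \<noteq> q\<close> by (intro image_eqI[of _ _ p]) auto
    qed (use r in auto)
  qed
  finally have "card (terminals Y ?N') \<le> card (?T - {q})"
    using finT by (meson card_image_le card_mono finite_Diff finite_imageI order_trans)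
  also have "\<dots> < card ?T" using finT q by (meson card_Diff1_less)
  finally show ?thesis .
qed

text \<open>With \<open>x = 4 * a / t \<le> 1 / 2\<close>, the left side is at most
  \<open>exp (- 2 * x)\<close>, which is at most \<open>1 - x\<close>. In the induction below the
  left side is the gain from losing one of \<open>t\<close> terminals, and the right side bounds
  from below the fraction of cuts that survive.\<close>

lemma one_minus_inverse_powr_le:
  fixes a t :: real
  assumes "0 \<le> a" "8 * a \<le> t" "1 < t"
  shows "(1 - 1 / t) powr (8 * a) \<le> 1 - 4 * a / t"
proof -
  define x where "x = 4 * a / t"
  have x: "0 \<le> x" "x \<le> 1 / 2" using assms by (auto simp: x_def field_simps)
  have "ln (1 - 1 / t) \<le> - (1 / t)"
    using assms ln_le_minus_one[of "1 - 1 / t"] by simp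
  then have "8 * a * ln (1 - 1 / t) \<le> 8 * a * (- (1 / t))"
    using assms by (intro mult_left_mono) auto
  also have "\<dots> = - (2 * x)" by (simp add: x_def)
  also have "\<dots> \<le> - x - 2 * x\<^sup>2"
    using mult_left_mono[OF x(2) x(1)] by (simp add: power2_eq_square)
  also have "\<dots> \<le> ln (1 - x)" by (rule ln_one_minus_pos_lower_bound) (use x in auto)
  finally have "exp (8 * a * ln (1 - 1 / t)) \<le> exp (ln (1 - x))" by simp
  moreover have "1 - 1 / t > 0" "1 - x > 0" using assms x by (auto simp: field_simps)
  ultimately show ?thesis using assms(3) by (simp add: powr_def flip: x_def)
qed

text \<open>Induction on the size of \<open>N\<close>, with \<open>a = s / k\<close> and
  \<open>t\<close> terminals. If \<open>t \<le> 8 * a\<close>, a cut is determined by the set of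
  terminals on its side. Otherwise a close pair is merged, which costs at most a fraction
  \<open>4 * a / t\<close> of the cuts while \<open>t\<close> drops by at least one. The exponent
  \<open>8 * a\<close> is twice the constant of this loss, so that the gain outweighs it.\<close>

lemma projection_count_inj:
  assumes finV: "finite V" and finX: "finite X"
    and X: "\<And>e. e \<in> X \<Longrightarrow> e \<subseteq> V \<and> card e = 2"
    and YX: "Y \<subseteq> X" and hv: "heavy V k X Y" and k: "k > 0"
    and "N \<subseteq> Pow V" "\<And>A. A \<in> N \<Longrightarrow> card (cut_edges X A) \<le> s"
    and "\<And>A. A \<in> N \<Longrightarrow> cut_edges Y A \<noteq> {}"
    and "inj_on (cut_edges Y) N"
  shows "real (card N) \<le> (2 * real (card (terminals Y N))) powr (8 * (real s / k))"
  using assms(7-)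
proof (induction "card N" arbitrary: N rule: less_induct)
  case less
  let ?T = "terminals Y N" and ?a = "real s / k"
  have finN: "finite N" using less(2) finV by (meson finite_Pow_iff finite_subset)
  have "?T \<subseteq> Pow N" by (auto simp: terminals_def cut_trace_def)
  then have finT: "finite ?T" using finN by (meson finite_Pow_iff finite_subset)
  have a: "?a \<ge> 0" using k by simp
  show ?case
  proof (cases "N = {}")
    case False
    then obtain A where "A \<in> N" "cut_edges Y A \<noteq> {}"
      using less(4) by blast
    then obtain e where Ae: "A \<in> N" "e \<in> Y" "crosses A e"
      by (auto simp: cut_edges_def)
    then obtain x y where xy: "e = {x, y}" using X YX by (metis card_2_iff subset_iff)
    have "cut_trace N x \<in> ?T" "cut_trace N y \<in> ?T" "cut_trace N x \<noteq> cut_trace N y"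
      using cut_trace_in_terminals[OF Ae(2) _ Ae(1,3)] Ae(1,3)
      by (simp_all add: xy crosses_pair) (auto simp: cut_trace_def)
    then have two: "card ?T \<ge> 2"
      using finT by (metis card_le_Suc0_iff_eq not_less_eq_eq numeral_2_eq_2)
    show ?thesis
    proof (cases "real (card ?T) \<le> 8 * ?a")
      case True
      \<comment> \<open>Both ends of an edge of \<open>Y\<close> crossed by \<open>A\<close> or
        \<open>B\<close> have their traces among the terminals. Cuts containing the same terminals
        thus cross the same edges of \<open>Y\<close>, and are equal since
        \<open>cut_edges Y\<close> is injective on \<open>N\<close>.\<close>
      have "inj_on (\<lambda>A. {p \<in> ?T. A \<in> p}) N"
      proof (rule inj_onI)
        fix A B assume A: "A \<in> N" and B: "B \<in> N" and eq: "{p \<in> ?T. A \<in> p} = {p \<in> ?T. B \<in> p}"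
        have AB: "x \<in> A \<longleftrightarrow> x \<in> B" if "cut_trace N x \<in> ?T" for x
        proof -
          have "A \<in> cut_trace N x \<longleftrightarrow> B \<in> cut_trace N x" using that eq by blast
          then show ?thesis using A B by (simp add: cut_trace_def)
        qed
        have "crosses A e \<longleftrightarrow> crosses B e" if e: "e \<in> Y" for e
        proof -
          have "x \<in> A \<longleftrightarrow> x \<in> B" if "x \<in> e" "crosses A e \<or> crosses B e" for x
            using that cut_trace_in_terminals[OF e _ A] cut_trace_in_terminals[OF e _ B]
            by (intro AB) blast
          then have "e \<inter> A = e \<inter> B \<and> e - A = e - B" if "crosses A e \<or> crosses B e"
            using that by blast
          then show ?thesis unfolding crosses_def by metis
        qed
        then have "cut_edges Y A = cut_edges Y B" by (auto simp: cut_edges_def)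
        then show "A = B" using less(5) A B by (auto dest: inj_onD)
      qed
      then have "card N \<le> card (Pow ?T)"
        using finT by (intro card_inj_on_le) auto
      then have "real (card N) \<le> 2 powr real (card ?T)"
        using finT by (simp add: card_Pow powr_realpow flip: of_nat_le_iff)
      also have "\<dots> \<le> 2 powr (8 * ?a)" using True by (intro powr_mono) auto
      also have "\<dots> \<le> (2 * real (card ?T)) powr (8 * ?a)"
        using two a by (intro powr_mono2) auto
      finally show ?thesis .
    next
      case False
      define t where "t = real (card ?T)"
      have t: "t \<ge> 2" "8 * ?a < t" using two False by (auto simp: t_def)
      obtain p q where pq: "p \<in> ?T" "q \<in> ?T" "p \<noteq> q"
        "t * k * real (sdist p q) \<le> 4 * real (card N) * real s"
        using close_terminals[OF finV finX X YX hv k less(2,3) two] by (auto simp: t_def)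
      have sub: "sym_diff p q \<subseteq> N" using pq by (auto simp: terminals_def cut_trace_def)
      let ?N' = "N - sym_diff p q"
      have card': "real (card ?N') = real (card N) - real (sdist p q)"
        using card_Diff_subset[OF finite_subset[OF sub finN] sub] card_mono[OF finN sub]
        by (simp only: of_nat_diff)
      have d: "real (sdist p q) \<le> 4 * ?a / t * real (card N)"
        using pq(4) t k by (simp add: field_simps)
      have "card ?N' < card N"
        using sub finN pq(3) by (intro psubset_card_mono) auto
      then have IH: "real (card ?N') \<le> (2 * real (card (terminals Y ?N'))) powr (8 * ?a)"
        using less(2,3,4,5) by (intro less(1)) (auto intro: inj_on_subset)
      have "card (terminals Y ?N') < card ?T" by (rule terminals_merge) (use pq finN in auto)
      then have "real (card (terminals Y ?N')) \<le> t - 1" unfolding t_def by linarith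
      then have "(2 * real (card (terminals Y ?N'))) powr (8 * ?a) \<le> (2 * (t - 1)) powr (8 * ?a)"
        using a by (intro powr_mono2) auto
      also have "2 * (t - 1) = (2 * t) * (1 - 1 / t)" using t by (simp add: field_simps)
      also have "\<dots> powr (8 * ?a) = (2 * t) powr (8 * ?a) * (1 - 1 / t) powr (8 * ?a)"
        using t by (intro powr_mult)
      also have "\<dots> \<le> (2 * t) powr (8 * ?a) * (1 - 4 * ?a / t)"
        using t a by (intro mult_left_mono one_minus_inverse_powr_le) auto
      finally have "real (card ?N') \<le> (2 * t) powr (8 * ?a) * (1 - 4 * ?a / t)"
        using IH by linarith
      moreover have "real (card N) * (1 - 4 * ?a / t) \<le> real (card ?N')"
        using d card' by (simp add: algebra_simps)
      ultimately have "real (card N) * (1 - 4 * ?a / t) \<le> (2 * t) powr (8 * ?a) * (1 - 4 * ?a / t)"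
        by linarith
      moreover have "4 * ?a / t < 1"
        by (subst pos_divide_less_eq) (use t a in linarith)+
      then have "1 - 4 * ?a / t > 0" by simp
      ultimately show ?thesis unfolding t_def by (rule mult_right_le_imp_le)
    qed
  qed simp
qed

text \<open>Choosing one cut per trace supplies the injectivity. Terminals are traces of vertices,
  so there are at most \<open>card V\<close> of them.\<close>

lemma projection_count:
  assumes finV: "finite V" and finX: "finite X"
    and X: "\<And>e. e \<in> X \<Longrightarrow> e \<subseteq> V \<and> card e = 2"
    and YX: "Y \<subseteq> X" and hv: "heavy V k X Y" and k: "k > 0"
  shows "real (card {cut_edges Y A |A. A \<subseteq> V \<and> card (cut_edges X A) \<le> s \<and> cut_edges Y A \<noteq> {}})
           \<le> (2 * real (card V)) powr (8 * (real s / k))"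
proof -
  define M where "M = {A. A \<subseteq> V \<and> card (cut_edges X A) \<le> s \<and> cut_edges Y A \<noteq> {}}"
  obtain N where N: "N \<subseteq> M" "inj_on (cut_edges Y) N" "cut_edges Y ` M = cut_edges Y ` N"
    using subset_image_inj[THEN iffD1, OF order_refl] by metis
  have "terminals Y N \<subseteq> cut_trace N ` V"
    using X YX by (auto simp: terminals_def)
  then have T: "card (terminals Y N) \<le> card V"
    using finV by (meson card_image_le card_mono finite_imageI order_trans)
  have "{cut_edges Y A |A. A \<subseteq> V \<and> card (cut_edges X A) \<le> s \<and> cut_edges Y A \<noteq> {}} = cut_edges Y ` M"
    by (auto simp: M_def)
  then have "card {cut_edges Y A |A. A \<subseteq> V \<and> card (cut_edges X A) \<le> s \<and> cut_edges Y A \<noteq> {}} = card N"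
    using N by (simp add: card_image)
  also have "real (card N) \<le> (2 * real (card (terminals Y N))) powr (8 * (real s / k))"
    by (rule projection_count_inj[OF finV finX X YX hv k _ _ _ N(2)]) (use N(1) in \<open>auto simp: M_def\<close>)
  also have "\<dots> \<le> (2 * real (card V)) powr (8 * (real s / k))"
    using T k by (intro powr_mono2) auto
  finally show ?thesis .
qed

section \<open>Nagamochi-Ibaraki forests and contraction\<close>

lemma connected_in_refl: "connected_in H T u u"
  by (simp add: connected_in_def)

lemma connected_in_trans: "connected_in H T u v \<Longrightarrow> connected_in H T v w \<Longrightarrow> connected_in H T u w"
  by (auto simp: connected_in_def)

lemma connected_in_sym:
  assumes "connected_in H T u v"
  shows "connected_in H T v u"
proof -
  have "sym ({(x, y). \<exists>e\<in>T. mends H e = {x, y}}\<^sup>*)"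
    by (intro sym_rtrancl) (auto simp: sym_def insert_commute)
  then show ?thesis using assms by (auto simp: connected_in_def dest: symD)
qed

lemma connected_in_mono:
  assumes "connected_in H T u v" "T \<subseteq> T'"
  shows "connected_in H T' u v"
proof -
  have "{(x, y). \<exists>e\<in>T. mends H e = {x, y}} \<subseteq> {(x, y). \<exists>e\<in>T'. mends H e = {x, y}}"
    using assms(2) by blast
  from rtrancl_mono[OF this] assms(1) show ?thesis
    unfolding connected_in_def by (rule subsetD)
qed

lemma connected_in_edge: "e \<in> T \<Longrightarrow> mends H e = {u, v} \<Longrightarrow> connected_in H T u v"
  by (auto simp: connected_in_def intro!: r_into_rtrancl)

text \<open>A walk becomes a simple path edge by edge: on returning to a visited vertex, the path is
  cut back to it. Simplicity is what \<open>is_cycle\<close> asks for.\<close>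

lemma simple_path_exists:
  assumes "connected_in H T u v"
  shows "\<exists>vs es. length vs = Suc (length es) \<and> vs ! 0 = u \<and> vs ! length es = v \<and> distinct vs \<and>
           (\<forall>i<length es. es ! i \<in> T \<and> mends H (es ! i) = {vs ! i, vs ! Suc i})"
  using assms unfolding connected_in_def
proof (induction rule: rtrancl_induct)
  case base
  show ?case by (rule exI[of _ "[u]"], rule exI[of _ "[]"]) simp
next
  case (step v w)
  then obtain vs es where p: "length vs = Suc (length es)" "vs ! 0 = u" "vs ! length es = v"
      "distinct vs" "\<And>i. i < length es \<Longrightarrow> es ! i \<in> T \<and> mends H (es ! i) = {vs ! i, vs ! Suc i}"
    by blast
  obtain e where e: "e \<in> T" "mends H e = {v, w}" using step(2) by blast
  show ?case
  proof (cases "w \<in> set vs")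
    case True
    then obtain j where j: "j < length vs" "vs ! j = w" by (meson in_set_conv_nth)
    then have "j \<le> length es" using p(1) by simp
    then show ?thesis
      by (intro exI[of _ "take (Suc j) vs"] exI[of _ "take j es"])
        (use j p in \<open>auto simp: min_absorb2\<close>)
  next
    case False
    show ?thesis
      by (rule exI[of _ "vs @ [w]"], rule exI[of _ "es @ [e]"])
        (use False p e in \<open>auto simp: nth_append less_Suc_eq\<close>)
  qed
qed

text \<open>A simple path in \<open>T\<close> between the ends of \<open>e\<close> is closed to a
  cycle by \<open>e\<close>. The edges on the path are distinct because their end pairs are.\<close>

lemma forest_insert_not_connected:
  assumes forest: "forest H (insert e T)" and e: "e \<notin> T" "mends H e = {u, v}"
  shows "\<not> connected_in H T u v"
proof
  assume "connected_in H T u v"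
  then obtain vs es where p: "length vs = Suc (length es)" "vs ! 0 = u" "vs ! length es = v"
      "distinct vs" and ends: "\<And>i. i < length es \<Longrightarrow> es ! i \<in> T \<and> mends H (es ! i) = {vs ! i, vs ! Suc i}"
    using simple_path_exists by metis
  have "i = j" if "i < length es" "j < length es" "es ! i = es ! j" for i j
  proof -
    have "{vs ! i, vs ! Suc i} = {vs ! j, vs ! Suc j}" using that ends by metis
    then show ?thesis
      using that p(1,4) by (auto simp: doubleton_eq_iff nth_eq_iff_index_eq)
  qed
  then have "distinct es" by (auto simp: distinct_conv_nth)
  moreover have T: "set es \<subseteq> T" using ends by (auto simp: in_set_conv_nth)
  moreover have "mends H ((es @ [e]) ! i) = {vs ! i, vs ! (Suc i mod length vs)}"
    if "i < length vs" for i
  proof (cases "i = length es")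
    case True
    then show ?thesis using p e by (auto simp: nth_append insert_commute)
  next
    case False
    then have "i < length es" "Suc i mod length vs = Suc i" using that p(1) by auto
    then show ?thesis using ends by (simp add: nth_append)
  qed
  ultimately have "is_cycle H vs (es @ [e])"
    using p(1,4) e by (auto simp: is_cycle_def)
  moreover have "set (es @ [e]) \<subseteq> insert e T" using T by auto
  ultimately show False using forest unfolding forest_def by blast
qed

lemma forest_subset: "forest H T' \<Longrightarrow> T \<subseteq> T' \<Longrightarrow> forest H T"
  by (auto simp: forest_def)

lemma multigraph_edge:
  assumes "multigraph H" "e \<in> medges H"
  obtains u v where "mends H e = {u, v}" "u \<noteq> v" "u \<in> mverts H" "v \<in> mverts H"
  using assms by (auto simp: multigraph_def card_2_iff)

text \<open>Each edge added to a forest joins two components, so their number drops. This bounds the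
  number of edges of a forest by the number of vertices.\<close>

lemma forest_components:
  assumes H: "multigraph H" and "finite T" and "T \<subseteq> medges H" and "forest H T"
  shows "card ((\<lambda>v. {w \<in> mverts H. connected_in H T v w}) ` mverts H) + card T \<le> card (mverts H)"
  using assms(2-)
proof (induction T rule: finite_induct)
  case empty
  show ?case using H by (simp add: card_image_le multigraph_def)
next
  case (insert e T)
  define comp where "comp T v = {w \<in> mverts H. connected_in H T v w}" for T v
  let ?S = "comp T ` mverts H" and ?S' = "comp (insert e T) ` mverts H"
  have finS: "finite ?S" using H by (simp add: multigraph_def)
  obtain u v where uv: "mends H e = {u, v}" "u \<noteq> v" "u \<in> mverts H" "v \<in> mverts H"
    using H insert(4) multigraph_edge by (metis insert_subset)
  have "\<not> connected_in H T u v"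
    using forest_insert_not_connected insert(2,5) uv(1) by metis
  then have ne: "comp T u \<noteq> comp T v"
    using uv connected_in_refl by (fastforce simp: comp_def)
  \<comment> \<open>\<open>g\<close> sends an old component to the new one containing it. It reaches
    all new components even without the old component of \<open>v\<close>, which has the same image
    as that of \<open>u\<close>.\<close>
  define g where "g C = \<Union>(comp (insert e T) ` C)" for C
  have cong: "comp (insert e T) x = comp (insert e T) y" if "connected_in H (insert e T) x y" for x y
  proof -
    have "connected_in H (insert e T) x w \<longleftrightarrow> connected_in H (insert e T) y w" for w
      using that connected_in_trans connected_in_sym by metis
    then show ?thesis by (simp add: comp_def)
  qed
  have g: "g (comp T w) = comp (insert e T) w" if w: "w \<in> mverts H" for w
  proof -
    have "comp (insert e T) x = comp (insert e T) w" if "x \<in> comp T w" for x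
    proof -
      have "connected_in H (insert e T) w x"
        using that connected_in_mono[of H T w x "insert e T"] by (auto simp: comp_def)
      then show ?thesis by (rule cong[symmetric])
    qed
    moreover have "w \<in> comp T w" using w connected_in_refl by (auto simp: comp_def)
    ultimately show ?thesis unfolding g_def by blast
  qed
  have "comp (insert e T) u = comp (insert e T) v"
    using uv(1) by (intro cong connected_in_edge) auto
  then have guv: "g (comp T u) = g (comp T v)" using g uv by simp
  have "?S' \<subseteq> g ` (?S - {comp T v})"
  proof
    fix C assume "C \<in> ?S'"
    then obtain w where w: "w \<in> mverts H" "C = g (comp T w)" using g by auto
    show "C \<in> g ` (?S - {comp T v})"
    proof (cases "comp T w = comp T v")
      case True
      then show ?thesis using w guv ne uv by (intro image_eqI[of _ _ "comp T u"]) auto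
    qed (use w in auto)
  qed
  then have "card ?S' \<le> card (?S - {comp T v})"
    using finS by (meson card_image_le card_mono finite_Diff finite_imageI order_trans)
  also have "\<dots> < card ?S" using finS uv by (intro card_Diff1_less) auto
  finally have "card ?S' < card ?S" .
  moreover have "card ?S + card T \<le> card (mverts H)"
    using insert forest_subset[of H "insert e T" T] by (auto simp: comp_def)
  ultimately show ?case using insert(1,2) by (simp add: comp_def)
qed

text \<open>A single edge with two distinct ends contains no cycle, so any edge of \<open>R\<close>
  could be added to the empty forest.\<close>

lemma maximal_forest_empty:
  assumes H: "multigraph H" and R: "R \<subseteq> medges H" and max: "maximal_forest H R {}"
  shows "R = {}"
proof (rule ccontr)
  assume "R \<noteq> {}"
  then obtain e where e: "e \<in> R" by blast
  have "\<not> is_cycle H vs es" if "set es \<subseteq> {e}" for vs es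
  proof
    assume c: "is_cycle H vs es"
    then have "length es = card (set es)" by (simp add: is_cycle_def distinct_card)
    also have "\<dots> \<le> 1" using that card_mono[of "{e}" "set es"] by simp
    finally have "length es = 1" "length vs = 1" using c by (cases vs; simp add: is_cycle_def)+
    then have "mends H (es ! 0) = {vs ! 0}" using c by (auto simp: is_cycle_def)
    moreover have "es ! 0 \<in> set es" using \<open>length es = 1\<close> by (intro nth_mem) simp
    then have "es ! 0 = e" using that by blast
    moreover have "card (mends H e) = 2" using H R e by (auto simp: multigraph_def)
    ultimately show False by simp
  qed
  then have "forest H {e}" by (auto simp: forest_def)
  then show False using max e by (auto simp: maximal_forest_def)
qed

text \<open>If this forest were empty, the first \<open>floor k\<close> forests would contain all
  edges, and each has at most as many edges as there are vertices. It guarantees progress in every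
  contraction of \<open>contract_heavy\<close>.\<close>

lemma NI_forest_nonempty:
  assumes H: "multigraph H" and T: "NI_forests H T" and k: "k \<ge> 0"
    and many: "real (card (medges H)) > k * real (card (mverts H))"
  shows "T (nat \<lfloor>k\<rfloor> + 1) \<noteq> {}"
proof
  define l where "l = nat \<lfloor>k\<rfloor>"
  assume "T (nat \<lfloor>k\<rfloor> + 1) = {}"
  then have "maximal_forest H (medges H - (\<Union>i\<in>{1..<l + 1}. T i)) {}"
    using T unfolding NI_forests_def l_def by (metis le_add2)
  then have "medges H - (\<Union>i\<in>{1..<l + 1}. T i) = {}"
    using H by (intro maximal_forest_empty) auto
  then have cover: "medges H \<subseteq> (\<Union>i\<in>{1..<l + 1}. T i)" by blast
  have sub: "T i \<subseteq> medges H" if "i \<ge> 1" for i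
    using T that by (auto simp: NI_forests_def)
  have finH: "finite (medges H)" using H by (simp add: multigraph_def)
  have fin: "finite (T i)" if "i \<ge> 1" for i
    using sub[OF that] finH by (rule finite_subset)
  have "card (T i) \<le> card (mverts H)" if "i \<ge> 1" for i
    using forest_components[OF H fin[OF that] sub[OF that]] T that
    by (auto simp: NI_forests_def maximal_forest_def)
  then have le: "(\<Sum>i\<in>{1..<l + 1}. card (T i)) \<le> (\<Sum>i\<in>{1..<l + 1}. card (mverts H))"
    by (intro sum_mono) auto
  have "finite (\<Union>i\<in>{1..<l + 1}. T i)" using fin by auto
  then have "card (medges H) \<le> card (\<Union>i\<in>{1..<l + 1}. T i)" using cover by (rule card_mono)
  also have "\<dots> \<le> (\<Sum>i\<in>{1..<l + 1}. card (T i))" by (rule card_UN_le) simp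
  also note le
  finally have "card (medges H) \<le> l * card (mverts H)" by simp
  then have "real (card (medges H)) \<le> real l * real (card (mverts H))"
    by (metis of_nat_le_iff of_nat_mult)
  also have "\<dots> \<le> k * real (card (mverts H))"
    using k by (intro mult_right_mono) (auto simp: l_def)
  finally show False using many by simp
qed

section \<open>Contraction merges only highly connected vertices\<close>

definition joined :: "'v set \<Rightarrow> real \<Rightarrow> 'v set set \<Rightarrow> 'v \<Rightarrow> 'v \<Rightarrow> bool" where
  "joined V k X u v \<longleftrightarrow> (\<forall>A\<subseteq>V. crosses A {u, v} \<longrightarrow> k \<le> real (card (cut_edges X A)))"

text \<open>A cut that separates \<open>u\<close> from \<open>w\<close> separates \<open>v\<close>
  from one of them. Transitivity lets the property pass along chains of contracted edges.\<close>

lemma joined_trans: "joined V k X u v \<Longrightarrow> joined V k X v w \<Longrightarrow> joined V k X u w"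
  unfolding joined_def crosses_pair by blast

lemma joined_refl: "joined V k X u u"
  by (auto simp: joined_def crosses_def)

text \<open>The map \<open>\<phi>\<close> sends each vertex to the block into which it has been merged.\<close>

definition contraction_via :: "'v set \<Rightarrow> real \<Rightarrow> 'v set set \<Rightarrow> 'v cgraph \<Rightarrow> ('v \<Rightarrow> 'v set) \<Rightarrow> bool" where
  "contraction_via V k X H \<phi> \<longleftrightarrow> mverts H = \<phi> ` V \<and>
     (\<forall>v\<in>V. v \<in> \<phi> v) \<and> (\<forall>u\<in>V. \<forall>v\<in>V. u \<in> \<phi> v \<longrightarrow> \<phi> u = \<phi> v) \<and>
     (\<forall>e\<in>X. mends H e = \<phi> ` e) \<and> medges H = {e \<in> X. \<not> is_singleton (\<phi> ` e)} \<and>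
     (\<forall>u\<in>V. \<forall>v\<in>V. \<phi> u = \<phi> v \<longrightarrow> joined V k X u v)"

lemma contraction_viaD:
  assumes "contraction_via V k X H \<phi>"
  shows "mverts H = \<phi> ` V"
    and "v \<in> V \<Longrightarrow> v \<in> \<phi> v"
    and "u \<in> V \<Longrightarrow> v \<in> V \<Longrightarrow> u \<in> \<phi> v \<Longrightarrow> \<phi> u = \<phi> v"
    and "e \<in> X \<Longrightarrow> mends H e = \<phi> ` e"
    and "medges H = {e \<in> X. \<not> is_singleton (\<phi> ` e)}"
    and "u \<in> V \<Longrightarrow> v \<in> V \<Longrightarrow> \<phi> u = \<phi> v \<Longrightarrow> joined V k X u v"
  using assms unfolding contraction_via_def by metis+

lemma merged_eq:
  assumes "connected_in H T B C"
  shows "merged H T B = merged H T C"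
proof -
  have "connected_in H T B D \<longleftrightarrow> connected_in H T C D" for D
    using assms connected_in_trans connected_in_sym by metis
  then show ?thesis by (simp add: merged_def)
qed

lemma finite_edges:
  assumes "finite V" "\<And>e. e \<in> X \<Longrightarrow> e \<subseteq> V \<and> card e = 2"
  shows "finite X"
  using assms by (meson Pow_iff finite_Pow_iff finite_subset subsetI)

context
  fixes V :: "'v set" and X :: "'v set set" and k :: real
  assumes finV: "finite V" and X: "\<And>e. e \<in> X \<Longrightarrow> e \<subseteq> V \<and> card e = 2" and k: "k \<ge> 0"
begin

private lemmas finX = finite_edges[OF finV X]

lemma contraction_multigraph:
  assumes "contraction_via V k X H \<phi>"
  shows "multigraph H"
proof -
  have "card (\<phi> ` e) = 2" if e: "e \<in> X" "\<not> is_singleton (\<phi> ` e)" for e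
  proof -
    obtain u v where "e = {u, v}" using X[OF e(1)] by (auto simp: card_2_iff)
    then show ?thesis using e(2) by (auto simp: is_singleton_def card_insert_if)
  qed
  moreover have "\<phi> ` e \<subseteq> \<phi> ` V" if "e \<in> X" for e
    using X[OF that] by (intro image_mono) simp
  ultimately show ?thesis
    using finV finX by (simp add: multigraph_def contraction_viaD(1,4,5)[OF assms])
qed

lemma uncontracted_contraction: "contraction_via V k X (uncontracted V X) (\<lambda>v. {v})"
proof -
  have "\<not> is_singleton ((\<lambda>v. {v}) ` e)" if e: "e \<in> X" for e
  proof -
    obtain u v where "e = {u, v}" "u \<noteq> v" using X[OF e] by (auto simp: card_2_iff)
    then show ?thesis by (auto simp: is_singleton_def)
  qed
  then show ?thesis by (auto simp: contraction_via_def uncontracted_def joined_refl)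
qed

text \<open>A cut \<open>A\<close> either splits a block, whose vertices are already joined, or is a
  union of blocks and so corresponds to a cut of \<open>H\<close> crossed by the same edges.\<close>

lemma connected_cut:
  assumes \<phi>: "contraction_via V k X H \<phi>" and Q: "Q \<subseteq> X"
    and conn: "edge_connected_in H Q j B C" and kj: "k \<le> real j"
    and u: "u \<in> V" "\<phi> u = B" and v: "v \<in> V" "\<phi> v = C"
  shows "joined V k X u v"
  unfolding joined_def
proof (intro allI impI)
  fix A assume A: "A \<subseteq> V" "crosses A {u, v}"
  show "k \<le> real (card (cut_edges X A))"
  proof (cases "\<exists>x\<in>A. \<exists>y\<in>V - A. \<phi> x = \<phi> y")
    case True
    then obtain x y where xy: "x \<in> A" "y \<in> V - A" "\<phi> x = \<phi> y" by blast
    then have "joined V k X x y" using A(1) by (intro contraction_viaD(6)[OF \<phi>]) auto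
    then show ?thesis using xy A(1) by (auto simp: joined_def crosses_pair)
  next
    case False
    have sat: "\<phi> x \<in> \<phi> ` A \<longleftrightarrow> x \<in> A" if "x \<in> V" for x
      using False that by (metis DiffI imageE imageI)
    have cr: "crosses (\<phi> ` A) (mends H e) \<longleftrightarrow> crosses A e"
      and cr': "crosses (\<phi> ` V - \<phi> ` A) (mends H e) \<longleftrightarrow> crosses A e" if e: "e \<in> X" for e
    proof -
      obtain x y where xy: "e = {x, y}" "x \<in> V" "y \<in> V"
        using X[OF e] by (metis card_2_iff insert_subset)
      then have "mends H e = {\<phi> x, \<phi> y}" using contraction_viaD(4)[OF \<phi> e] by simp
      then show "crosses (\<phi> ` A) (mends H e) \<longleftrightarrow> crosses A e"
        and "crosses (\<phi> ` V - \<phi> ` A) (mends H e) \<longleftrightarrow> crosses A e"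
        using sat[of x] sat[of y] xy by (simp_all add: crosses_pair)
    qed
    have sub: "{e \<in> Q. crosses A e} \<subseteq> cut_edges X A" using Q by (auto simp: cut_edges_def)
    \<comment> \<open>\<open>edge_connected_in\<close> speaks of sets that contain \<open>B\<close>,
      so for \<open>u\<close> outside \<open>A\<close> the complementary set of blocks is
      taken.\<close>
    have "j \<le> card {e \<in> Q. crosses A e}"
    proof (cases "u \<in> A")
      case True
      then have "\<phi> ` A \<subseteq> mverts H" "B \<in> \<phi> ` A" "C \<notin> \<phi> ` A"
        using A u v sat[of u] sat[of v] contraction_viaD(1)[OF \<phi>] by (auto simp: crosses_pair)
      then have "j \<le> card {e \<in> Q. crosses (\<phi> ` A) (mends H e)}"
        using conn by (auto simp: edge_connected_in_def)
      also have "{e \<in> Q. crosses (\<phi> ` A) (mends H e)} = {e \<in> Q. crosses A e}"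
        using cr Q by auto
      finally show ?thesis .
    next
      case False
      then have "\<phi> ` V - \<phi> ` A \<subseteq> mverts H" "B \<in> \<phi> ` V - \<phi> ` A" "C \<notin> \<phi> ` V - \<phi> ` A"
        using A u v sat[of u] sat[of v] contraction_viaD(1)[OF \<phi>] by (auto simp: crosses_pair)
      then have "j \<le> card {e \<in> Q. crosses (\<phi> ` V - \<phi> ` A) (mends H e)}"
        using conn by (auto simp: edge_connected_in_def)
      also have "{e \<in> Q. crosses (\<phi> ` V - \<phi> ` A) (mends H e)} = {e \<in> Q. crosses A e}"
        using cr' Q by auto
      finally show ?thesis .
    qed
    also have "\<dots> \<le> card (cut_edges X A)"
      using sub finX cut_edges_subset by (meson card_mono finite_subset)
    finally show ?thesis using kj by linarith
  qed
qed

text \<open>Merged blocks are linked by a chain of edges of \<open>T j\<close>. The ends of each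
  such edge are \<open>j\<close>-edge-connected in the first \<open>j\<close> forests, hence joined
  by \<open>connected_cut\<close> as \<open>k \<le> j\<close>, and being joined is
  transitive.\<close>

lemma contraction_step:
  assumes \<phi>: "contraction_via V k X H \<phi>" and T: "NI_forests H T" and j: "k \<le> real j" "j \<ge> 1"
  shows "contraction_via V k X (contract H (T j)) (\<lambda>v. merged H (T j) (\<phi> v))"
proof -
  let ?\<psi> = "\<lambda>v. merged H (T j) (\<phi> v)"
  have TE: "(\<Union>i\<in>{1..j}. T i) \<subseteq> medges H" using T by (auto simp: NI_forests_def)
  note V = contraction_viaD(1)[OF \<phi>]
  have EX: "medges H \<subseteq> X" unfolding contraction_viaD(5)[OF \<phi>] by blast
  have self: "v \<in> ?\<psi> v" if "v \<in> V" for v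
    using contraction_viaD(2)[OF \<phi> that] that V connected_in_refl unfolding merged_def by fastforce
  have conn: "connected_in H (T j) (\<phi> v) (\<phi> u)" if uv: "u \<in> V" "v \<in> V" "u \<in> ?\<psi> v" for u v
  proof -
    obtain w where "w \<in> V" "connected_in H (T j) (\<phi> v) (\<phi> w)" "u \<in> \<phi> w"
      using uv V by (auto simp: merged_def)
    moreover have "\<phi> u = \<phi> w" using calculation uv by (intro contraction_viaD(3)[OF \<phi>])
    ultimately show ?thesis by simp
  qed
  have step_joined: "joined V k X x y"
    if "x \<in> V" "y \<in> V" "e \<in> T j" "mends H e = {\<phi> x, \<phi> y}" for x y e
  proof (rule connected_cut[OF \<phi> _ _ j(1) that(1) refl that(2) refl])
    show "edge_connected_in H (\<Union>i\<in>{1..j}. T i) j (\<phi> x) (\<phi> y)"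
      using T j(2) that unfolding NI_forests_def by blast
    show "(\<Union>i\<in>{1..j}. T i) \<subseteq> X" using TE EX by blast
  qed
  have joined: "joined V k X u v" if "u \<in> V" "v \<in> V" "connected_in H (T j) (\<phi> u) (\<phi> v)" for u v
  proof -
    \<comment> \<open>The chain runs through blocks, so the induction claims the property for every
      vertex of the block reached.\<close>
    have "\<forall>w\<in>V. \<phi> w = B \<longrightarrow> joined V k X u w" if "connected_in H (T j) (\<phi> u) B" for B
      using that unfolding connected_in_def
    proof (induction rule: rtrancl_induct)
      case base
      show ?case using contraction_viaD(6)[OF \<phi> \<open>u \<in> V\<close>] by simp
    next
      case (step B C)
      then obtain e where e: "e \<in> T j" "mends H e = {B, C}" by blast
      have "e \<in> medges H" using T e(1) j(2) by (auto simp: NI_forests_def)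
      then have "mends H e \<subseteq> mverts H"
        using contraction_multigraph[OF \<phi>] by (simp add: multigraph_def)
      then obtain x where "x \<in> V" "\<phi> x = B" using e V by auto
      then show ?case using step(3) step_joined e joined_trans by metis
    qed
    then show ?thesis using that by blast
  qed
  show ?thesis
    unfolding contraction_via_def
  proof (intro conjI ballI impI)
    show "mverts (contract H (T j)) = ?\<psi> ` V" by (auto simp: contract_def V)
    show "v \<in> ?\<psi> v" if "v \<in> V" for v by (rule self[OF that])
    show "?\<psi> u = ?\<psi> v" if "u \<in> V" "v \<in> V" "u \<in> ?\<psi> v" for u v
      using merged_eq[OF conn[OF that]] by simp
    show "mends (contract H (T j)) e = ?\<psi> ` e" if "e \<in> X" for e
      using contraction_viaD(4)[OF \<phi> that] by (simp add: contract_def image_image)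
    have "is_singleton (?\<psi> ` e)" if e: "is_singleton (\<phi> ` e)" for e
    proof -
      obtain B where "\<phi> ` e = {B}" using e by (auto simp: is_singleton_def)
      then have "(merged H (T j)) ` \<phi> ` e = {merged H (T j) B}" by simp
      then show ?thesis by (simp add: image_image)
    qed
    then show "medges (contract H (T j)) = {e \<in> X. \<not> is_singleton (?\<psi> ` e)}"
      using contraction_viaD(4)[OF \<phi>] by (auto simp: contract_def contraction_viaD(5)[OF \<phi>] image_image)
    show "joined V k X u v" if "u \<in> V" "v \<in> V" "?\<psi> u = ?\<psi> v" for u v
    proof (rule joined[OF that(1,2)])
      show "connected_in H (T j) (\<phi> u) (\<phi> v)"
        using conn[of v u] self[of v] that by simp
    qed
  qed
qed

lemma contract_fewer_edges:
  assumes H: "multigraph H" and T: "T \<subseteq> medges H" "T \<noteq> {}"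
  shows "card (medges (contract H T)) < card (medges H)"
proof -
  obtain e where e: "e \<in> T" using T by blast
  then obtain B C where "mends H e = {B, C}" using H T multigraph_edge by (metis subsetD)
  moreover have "merged H T B = merged H T C"
    using e calculation by (intro merged_eq connected_in_edge) auto
  ultimately have "e \<notin> medges (contract H T)" by (simp add: contract_def is_singleton_def)
  then have "medges (contract H T) \<subset> medges H" using e T by (auto simp: contract_def)
  then show ?thesis using H by (intro psubset_card_mono) (auto simp: multigraph_def)
qed

text \<open>\<open>contraction_via\<close> is the loop invariant and the number of edges the
  termination measure. The loop condition gives more than \<open>k\<close> edges per vertex, so the
  contracted forest is nonempty, and its edges disappear as loops.\<close>

lemma contract_heavy_contraction:
  assumes NI: "NI_procedure NI"
  shows "\<exists>\<phi>. contraction_via V k X (contract_heavy NI V k X) \<phi>"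
  unfolding contract_heavy_def
proof (rule while_rule[where P = "\<lambda>H. \<exists>\<phi>. contraction_via V k X H \<phi>" and r = "Wellfounded.measure (\<lambda>H. card (medges H))"])
  show "\<exists>\<phi>. contraction_via V k X (uncontracted V X) \<phi>" using uncontracted_contraction by blast
next
  fix H :: "'v cgraph"
  assume "\<exists>\<phi>. contraction_via V k X H \<phi>"
  then obtain \<phi> where \<phi>: "contraction_via V k X H \<phi>" by blast
  then have H: "multigraph H" by (rule contraction_multigraph)
  then have T: "NI_forests H (NI H)" using NI by (simp add: NI_procedure_def)
  have "k \<le> real (nat \<lfloor>k\<rfloor> + 1)" "nat \<lfloor>k\<rfloor> + 1 \<ge> 1" by linarith simp
  from contraction_step[OF \<phi> T this]
  show "\<exists>\<phi>. contraction_via V k X (contract H (NI H (nat \<lfloor>k\<rfloor> + 1))) \<phi>" by blast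
  assume "real (card (medges H)) > 2 * k * real (card (mverts H))"
  then have "real (card (medges H)) > 2 * (k * real (card (mverts H)))" by (simp only: mult.assoc)
  moreover have "0 \<le> k * real (card (mverts H))" using k by simp
  ultimately have "real (card (medges H)) > k * real (card (mverts H))" by linarith
  then have "NI H (nat \<lfloor>k\<rfloor> + 1) \<noteq> {}" by (rule NI_forest_nonempty[OF H T k])
  moreover have "NI H (nat \<lfloor>k\<rfloor> + 1) \<subseteq> medges H" using T unfolding NI_forests_def by fastforce
  ultimately show "(contract H (NI H (nat \<lfloor>k\<rfloor> + 1)), H) \<in> Wellfounded.measure (\<lambda>H. card (medges H))"
    using contract_fewer_edges[OF H] by simp
qed auto

text \<open>An edge of \<open>X\<close> missing from the final contracted graph has both ends in one
  block, and such ends are joined.\<close>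

lemma contract_heavy_heavy:
  assumes NI: "NI_procedure NI"
  shows "medges (contract_heavy NI V k X) \<subseteq> X"
    and "heavy V k X (X - medges (contract_heavy NI V k X))"
proof -
  obtain \<phi> where \<phi>: "contraction_via V k X (contract_heavy NI V k X) \<phi>"
    using contract_heavy_contraction[OF NI] by blast
  then show "medges (contract_heavy NI V k X) \<subseteq> X" by (auto simp: contraction_via_def)
  have "joined V k X u v" if e: "{u, v} \<in> X - medges (contract_heavy NI V k X)" for u v
  proof -
    have "is_singleton (\<phi> ` {u, v})" "u \<in> V" "v \<in> V"
      using e \<phi> X by (auto simp: contraction_via_def)
    moreover have "\<phi> u = \<phi> v"
      using calculation(1) by (auto simp: is_singleton_def doubleton_eq_iff)
    ultimately show ?thesis using contraction_viaD(6)[OF \<phi>] by blast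
  qed
  then show "heavy V k X (X - medges (contract_heavy NI V k X))"
    unfolding heavy_def joined_def using X by (metis DiffD1 card_2_iff)
qed

end

text \<open>An edge outside \<open>F\<close> lies in a forest of index \<open>j > k\<close>, so its
  ends are \<open>j\<close>-edge-connected without any contraction. Nonemptiness of \<open>F\<close>
  will make the maximum in \<open>last_index\<close> well defined.\<close>

lemma initial_round_heavy:
  assumes "finite V" "\<And>e. e \<in> X \<Longrightarrow> e \<subseteq> V \<and> card e = 2" and "NI_procedure NI" and "k \<ge> 0"
  defines "F \<equiv> \<Union>j\<in>{j. 1 \<le> j \<and> real j \<le> k}. NI (uncontracted V X) j"
  shows "F \<subseteq> X" and "heavy V k X (X - F)" and "k \<ge> 1 \<Longrightarrow> X \<noteq> {} \<Longrightarrow> F \<noteq> {}"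
proof -
  let ?H = "uncontracted V X"
  note ctx = assms(1,2,4)
  have \<phi>: "contraction_via V k X ?H (\<lambda>v. {v})" by (rule uncontracted_contraction[OF ctx])
  have H: "multigraph ?H" by (rule contraction_multigraph[OF ctx \<phi>])
  then have T: "NI_forests ?H (NI ?H)" using assms(3) by (simp add: NI_procedure_def)
  have E: "medges ?H = X" by (simp add: uncontracted_def)
  show "F \<subseteq> X" using T E by (auto simp: F_def NI_forests_def)
  have "joined V k X u v" if e: "{u, v} \<in> X - F" for u v
  proof -
    have "(\<Union>j\<in>{1..}. NI ?H j) = X" using T E by (simp add: NI_forests_def)
    then obtain j where j: "j \<ge> 1" "{u, v} \<in> NI ?H j" using e by auto
    then have "\<not> real j \<le> k" using e by (auto simp: F_def)
    then have "k \<le> real j" by simp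
    have "mends ?H {u, v} = {{u}, {v}}" by (simp add: uncontracted_def)
    then have "edge_connected_in ?H (\<Union>i\<in>{1..j}. NI ?H i) j {u} {v}"
      using T j unfolding NI_forests_def by blast
    moreover have "(\<Union>i\<in>{1..j}. NI ?H i) \<subseteq> X" using T E by (auto simp: NI_forests_def)
    moreover have "u \<in> V" "v \<in> V" using assms(2)[of "{u, v}"] e by auto
    ultimately show ?thesis
      using \<open>k \<le> real j\<close> by (intro connected_cut[OF ctx \<phi>]) simp_all
  qed
  then show "heavy V k X (X - F)"
    unfolding heavy_def joined_def using assms(2) by (metis DiffD1 card_2_iff)
  show "F \<noteq> {}" if "k \<ge> 1" "X \<noteq> {}"
  proof
    assume "F = {}"
    then have "NI ?H 1 = {}" using \<open>k \<ge> 1\<close> by (auto simp: F_def)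
    moreover have "maximal_forest ?H (medges ?H - (\<Union>i\<in>{1..<1}. NI ?H i)) (NI ?H 1)"
      using T unfolding NI_forests_def by blast
    ultimately have "maximal_forest ?H X {}" using E by simp
    then show False using maximal_forest_empty[OF H] E that by simp
  qed
qed

section \<open>Sampling\<close>

lemma map_sample_half_card:
  assumes "finite Y" "D \<subseteq> Y"
  shows "map_pmf (\<lambda>Z. card (Z \<inter> D)) (sample_half Y) = binomial_pmf (card D) (1 / 2)"
proof -
  let ?p = "\<lambda>_. bernoulli_pmf (1 / 2)"
  have "binomial_pmf (card D) (1 / 2) = map_pmf (\<lambda>f. card {x \<in> D. f x}) (Pi_pmf D False ?p)"
    using assms by (intro binomial_pmf_altdef') (auto intro: finite_subset)
  also have "Pi_pmf D False ?p = map_pmf (\<lambda>f x. if x \<in> D then f x else False) (Pi_pmf Y False ?p)"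
    by (rule Pi_pmf_subset[OF assms])
  also have "map_pmf (\<lambda>f. card {x \<in> D. f x}) \<dots> = map_pmf (\<lambda>Z. card (Z \<inter> D)) (sample_half Y)"
    unfolding sample_half_def map_pmf_comp
  proof (intro map_pmf_cong refl arg_cong[where f = card])
    fix \<omega> show "{x \<in> D. if x \<in> D then \<omega> x else False} = {e \<in> Y. \<omega> e} \<inter> D" using assms by auto
  qed
  finally show ?thesis by simp
qed

text \<open>Hoeffding's inequality for the binomial number of sampled edges of \<open>D\<close>.
  Twice that number estimates \<open>card D\<close>, so a deviation \<open>t\<close> of the estimate
  is a deviation \<open>t / 2\<close> of the count.\<close>

lemma sample_half_deviation:
  assumes "finite Y" "D \<subseteq> Y" "D \<noteq> {}" "t \<ge> 0"
  shows "measure_pmf.prob (sample_half Y)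
           {Z. \<not> \<bar>2 * real (card (Z \<inter> D)) - real (card D)\<bar> \<le> t} \<le> 2 * exp (- (t\<^sup>2 / (2 * real (card D))))"
proof -
  have D: "card D > 0" using assms by (simp add: card_gt_0_iff finite_subset)
  interpret binomial_distribution "card D" "1 / 2" by unfold_locales simp
  have "measure_pmf.prob (sample_half Y) {Z. \<not> \<bar>2 * real (card (Z \<inter> D)) - real (card D)\<bar> \<le> t}
      = measure_pmf.prob (sample_half Y)
          ((\<lambda>Z. card (Z \<inter> D)) -` {x. \<not> \<bar>2 * real x - real (card D)\<bar> \<le> t})"
    by (rule arg_cong[where f = "measure_pmf.prob (sample_half Y)"]) auto
  also have "\<dots> = measure_pmf.prob (binomial_pmf (card D) (1 / 2)) {x. \<not> \<bar>2 * real x - real (card D)\<bar> \<le> t}"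
    unfolding map_sample_half_card[OF assms(1,2), symmetric] measure_map_pmf ..
  also have "\<dots> \<le> measure_pmf.prob (binomial_pmf (card D) (1 / 2)) {x. \<bar>real x - real (card D) * (1 / 2)\<bar> \<ge> t / 2}"
    by (intro measure_pmf.finite_measure_mono) (auto simp: abs_if split: if_splits)
  also have "\<dots> \<le> 2 * exp (- 2 * (t / 2)\<^sup>2 / real (card D))"
    using D assms(4) by (intro prob_abs_ge) auto
  also have "- 2 * (t / 2)\<^sup>2 / real (card D) = - (t\<^sup>2 / (2 * real (card D)))"
    by (simp add: power2_eq_square)
  finally show ?thesis .
qed

lemma set_pmf_sample_half: "Z \<in> set_pmf (sample_half Y) \<Longrightarrow> Z \<subseteq> Y"
  by (auto simp: sample_half_def)

lemma card_edges_le: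
  assumes "finite V" "\<And>e. e \<in> X \<Longrightarrow> e \<subseteq> V \<and> card e = 2"
  shows "card X \<le> (card V)\<^sup>2"
proof -
  have "X \<subseteq> (\<lambda>(u, v). {u, v}) ` (V \<times> V)"
  proof
    fix e assume "e \<in> X"
    then obtain u v where "e = {u, v}" "u \<in> V" "v \<in> V"
      using assms(2) by (metis card_2_iff insert_subset)
    then show "e \<in> (\<lambda>(u, v). {u, v}) ` (V \<times> V)" by auto
  qed
  then have "card X \<le> card (V \<times> V)"
    using assms(1) by (meson card_image_le card_mono finite_SigmaI finite_imageI order_trans)
  then show ?thesis by (simp add: card_cartesian_product power2_eq_square)
qed

text \<open>The error is measured against the cut in \<open>X\<close>, which is large whenever heavy
  edges of \<open>Y\<close> cross it. The part in \<open>Y\<close> may be a single edge, too small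
  for concentration relative to itself.\<close>

definition round_ok :: "'v set \<Rightarrow> real \<Rightarrow> 'v set set \<Rightarrow> 'v set set \<Rightarrow> 'v set set \<Rightarrow> bool" where
  "round_ok V \<delta> X Y Z \<longleftrightarrow>
     (\<forall>A\<subseteq>V. \<bar>2 * real (card (cut_edges Z A)) - real (card (cut_edges Y A))\<bar>
               \<le> \<delta> * real (card (cut_edges X A)))"

text \<open>Union bound over the size \<open>s\<close> of the cut in \<open>X\<close> and the trace
  on \<open>Y\<close>. With \<open>a = s / k\<close>, at most \<open>n powr (9 * a)\<close> traces
  fail, each with probability at most \<open>2 * n powr (- (27 / 2) * a)\<close>, and there are at
  most \<open>n ^ 2\<close> sizes.\<close>

lemma round_failure_prob:
  fixes V :: "'v set"
  defines "n \<equiv> real (card V)"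
  assumes finV: "finite V" and X: "\<And>e. e \<in> X \<Longrightarrow> e \<subseteq> V \<and> card e = 2"
    and YX: "Y \<subseteq> X" and hv: "heavy V k X Y" and k: "k > 0"
    and n: "n \<ge> 256" and \<delta>: "\<delta> > 0" "\<delta>\<^sup>2 * k \<ge> 27 * ln n"
  shows "measure_pmf.prob (sample_half Y) {Z. \<not> round_ok V \<delta> X Y Z} \<le> 2 / n\<^sup>2"
proof -
  have finX: "finite X" by (rule finite_edges[OF finV X])
  then have finY: "finite Y" using YX by (rule rev_finite_subset)
  define S where "S = {s. k \<le> real s \<and> s \<le> card X}"
  define \<D> where "\<D> s = {cut_edges Y A |A. A \<subseteq> V \<and> card (cut_edges X A) \<le> s \<and> cut_edges Y A \<noteq> {}}" for s
  define bad where "bad s D = {Z. \<not> \<bar>2 * real (card (Z \<inter> D)) - real (card D)\<bar> \<le> \<delta> * real s}"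
    for s and D :: "'v set set"
  let ?P = "measure_pmf.prob (sample_half Y)"
  have finS: "finite S" unfolding S_def by (rule finite_subset[of _ "{..card X}"]) auto
  have fin\<D>: "finite (\<D> s)" for s
    using finV by (intro finite_subset[of "\<D> s" "cut_edges Y ` Pow V"]) (auto simp: \<D>_def)
  \<comment> \<open>Whether a cut fails depends only on its size in \<open>X\<close> and its trace
    on \<open>Y\<close>. An empty trace has no error, and a nonempty one forces size at least
    \<open>k\<close> by heaviness.\<close>
  have "{Z. \<not> round_ok V \<delta> X Y Z} \<inter> set_pmf (sample_half Y) \<subseteq> (\<Union>s\<in>S. \<Union>D\<in>\<D> s. bad s D)"
  proof
    fix Z assume "Z \<in> {Z. \<not> round_ok V \<delta> X Y Z} \<inter> set_pmf (sample_half Y)"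
    then obtain A where A: "A \<subseteq> V" and Z: "Z \<subseteq> Y"
      and dev: "\<not> \<bar>2 * real (card (cut_edges Z A)) - real (card (cut_edges Y A))\<bar>
                   \<le> \<delta> * real (card (cut_edges X A))"
      using set_pmf_sample_half by (auto simp: round_ok_def)
    let ?D = "cut_edges Y A" and ?s = "card (cut_edges X A)"
    have ZD: "cut_edges Z A = Z \<inter> ?D" using Z by (auto simp: cut_edges_def)
    have "?D \<noteq> {}"
    proof
      assume "?D = {}"
      then show False using dev ZD \<delta> by simp
    qed
    then obtain e where "e \<in> Y" "crosses A e" by (auto simp: cut_edges_def)
    then have "k \<le> real ?s" using hv A by (auto simp: heavy_def)
    then have "?s \<in> S" using finX by (auto simp: S_def intro!: card_mono cut_edges_subset)
    moreover have "?D \<in> \<D> ?s" using A \<open>?D \<noteq> {}\<close> by (auto simp: \<D>_def)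
    moreover have "Z \<in> bad ?s ?D" using dev ZD by (simp add: bad_def)
    ultimately show "Z \<in> (\<Union>s\<in>S. \<Union>D\<in>\<D> s. bad s D)" by blast
  qed
  then have "?P {Z. \<not> round_ok V \<delta> X Y Z} \<le> ?P (\<Union>s\<in>S. \<Union>D\<in>\<D> s. bad s D)"
    by (subst measure_Int_set_pmf[symmetric]) (intro measure_pmf.finite_measure_mono; simp)
  also have "\<dots> \<le> (\<Sum>s\<in>S. ?P (\<Union>D\<in>\<D> s. bad s D))"
    using finS by (intro measure_pmf.finite_measure_subadditive_finite) auto
  also have "\<dots> \<le> (\<Sum>s\<in>S. 2 / n ^ 4)"
  proof (rule sum_mono)
    fix s assume "s \<in> S"
    then have ks: "k \<le> real s" by (simp add: S_def)
    define a where "a = real s / k"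
    have a: "a \<ge> 1" using ks k by (simp add: a_def)
    have "?P (bad s D) \<le> 2 * n powr (- (27 / 2) * a)" if D: "D \<in> \<D> s" for D
    proof -
      obtain A where A: "D = cut_edges Y A" "A \<subseteq> V" "card (cut_edges X A) \<le> s" "D \<noteq> {}"
        using D by (auto simp: \<D>_def)
      have "D \<subseteq> cut_edges X A" using A(1) YX by (auto simp: cut_edges_def)
      then have "card D \<le> s"
        using A(3) finX cut_edges_subset by (meson card_mono finite_subset order_trans)
      moreover have "card D > 0" using A finY cut_edges_subset by (metis card_gt_0_iff finite_subset)
      moreover have "?P (bad s D) \<le> 2 * exp (- ((\<delta> * real s)\<^sup>2 / (2 * real (card D))))"
        unfolding bad_def using A \<delta> finY cut_edges_subset by (intro sample_half_deviation) auto
      \<comment> \<open>As \<open>card D \<le> s\<close>, the exponent is at least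
        \<open>\<delta> ^ 2 * s / 2\<close>, and \<open>s = a * k\<close> brings in the assumption
        on \<open>\<delta> ^ 2 * k\<close>.\<close>
      moreover have "27 / 2 * a * ln n \<le> (\<delta> * real s)\<^sup>2 / (2 * real (card D))"
      proof -
        have "27 / 2 * a * ln n \<le> a / 2 * (\<delta>\<^sup>2 * k)"
          using mult_left_mono[OF \<delta>(2), of "a / 2"] a by simp
        also have "\<dots> = (\<delta> * real s)\<^sup>2 / (2 * real s)"
          using k ks by (simp add: a_def power2_eq_square)
        also have "\<dots> \<le> (\<delta> * real s)\<^sup>2 / (2 * real (card D))"
          using \<open>card D \<le> s\<close> \<open>card D > 0\<close> by (intro divide_left_mono) auto
        finally show ?thesis .
      qed
      ultimately have "?P (bad s D) \<le> 2 * exp (- (27 / 2 * a * ln n))" by (smt (verit) exp_le_cancel_iff)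
      then show ?thesis using n by (simp add: powr_def)
    qed
    then have "?P (\<Union>D\<in>\<D> s. bad s D) \<le> (\<Sum>D\<in>\<D> s. 2 * n powr (- (27 / 2) * a))"
      using fin\<D> by (intro order_trans[OF measure_pmf.finite_measure_subadditive_finite] sum_mono) auto
    also have "\<dots> = real (card (\<D> s)) * (2 * n powr (- (27 / 2) * a))" by simp
    also have "\<dots> \<le> n powr (9 * a) * (2 * n powr (- (27 / 2) * a))"
    proof (rule mult_right_mono)
      have "real (card (\<D> s)) \<le> (2 * n) powr (8 * a)"
        unfolding \<D>_def n_def a_def by (rule projection_count[OF finV finX X YX hv k])
      also have "\<dots> = ((2 * n) powr 8) powr a" by (simp add: powr_powr)
      also have "\<dots> \<le> (n powr 9) powr a"
      proof (rule powr_mono2)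
        \<comment> \<open>Here \<open>n \<ge> 256 = 2 ^ 8\<close> absorbs the constant into one more
          factor \<open>n\<close>.\<close>
        have "(2 * n) ^ 8 = 256 * n ^ 8" by (simp add: power_mult_distrib)
        also have "\<dots> \<le> n * n ^ 8" using n by (intro mult_right_mono) auto
        also have "\<dots> = n ^ 9" by (simp add: power_Suc[symmetric] del: power_Suc)
        finally show "(2 * n) powr 8 \<le> n powr 9"
          using n by (simp add: powr_numeral)
      qed (use a in auto)
      also have "\<dots> = n powr (9 * a)" by (simp add: powr_powr)
      finally show "real (card (\<D> s)) \<le> n powr (9 * a)" .
    qed simp
    also have "\<dots> = 2 * n powr (- (9 / 2) * a)" by (simp flip: powr_add)
    \<comment> \<open>Of these four powers of \<open>n\<close>, available since
      \<open>a \<ge> 1\<close>, two pay for the sum over the sizes.\<close>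
    also have "\<dots> \<le> 2 * n powr (- 4)"
      using a n by (intro mult_left_mono powr_mono) auto
    also have "\<dots> = 2 / n ^ 4" using n by (simp add: powr_minus powr_numeral divide_inverse)
    finally show "?P (\<Union>D\<in>\<D> s. bad s D) \<le> 2 / n ^ 4" .
  qed
  also have "\<dots> = real (card S) * (2 / n ^ 4)" by simp
  also have "\<dots> \<le> n\<^sup>2 * (2 / n ^ 4)"
  proof (rule mult_right_mono)
    have "s \<in> {1..card X}" if "s \<in> S" for s using that k by (cases s) (auto simp: S_def)
    then have "card S \<le> card {1..card X}" by (intro card_mono) auto
    also have "\<dots> \<le> (card V)\<^sup>2" using card_edges_le[OF finV X] by simp
    finally show "real (card S) \<le> n\<^sup>2" unfolding n_def by (metis of_nat_le_iff of_nat_power)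
  qed (use n in auto)
  also have "\<dots> = 2 / n\<^sup>2" using n by (simp add: field_simps flip: power_add)
  finally show ?thesis .
qed

text \<open>In round \<open>i\<close> the heaviness threshold is \<open>k = \<rho> * 2 ^ (i + 1)\<close> and a relative error \<open>\<delta>\<close> per cut
  is affordable once \<open>\<delta>\<^sup>2 * k\<close> is at least \<open>27 * ln n\<close>, so \<open>\<delta>\<close> may shrink by a factor \<open>1 / sqrt 2\<close> per
  round; \<open>71 / 100\<close> is a rational upper bound of it. With \<open>\<epsilon> / 14\<close> in front, the geometric series
  stays below \<open>\<epsilon> / 4\<close>, leaving room for the factor \<open>4 / 3\<close> from compounding.\<close>

definition round_error :: "real \<Rightarrow> nat \<Rightarrow> real" where
  "round_error \<epsilon> i = \<epsilon> / 14 * (71 / 100) ^ i"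

section \<open>Accumulation of the errors over the rounds\<close>

lemma sum_round_error_le:
  assumes "0 \<le> \<epsilon>"
  shows "4 / 3 * (\<Sum>i<j. round_error \<epsilon> i) \<le> \<epsilon> / 3"
proof -
  \<comment> \<open>\<open>100 / 29\<close> is the infinite geometric sum with ratio
    \<open>71 / 100\<close>, and \<open>4 / 3 * (1 / 14) * (100 / 29) < 1 / 3\<close>.\<close>
  have "(\<Sum>i<j. (71 / 100 :: real) ^ i) \<le> 100 / 29"
    by (subst geometric_sum) (auto simp: field_simps)
  then have "\<epsilon> / 14 * (\<Sum>i<j. (71 / 100 :: real) ^ i) \<le> \<epsilon> / 14 * (100 / 29)"
    using assms by (intro mult_left_mono) auto
  then have "(\<Sum>i<j. round_error \<epsilon> i) \<le> \<epsilon> / 14 * (100 / 29)"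
    by (simp only: round_error_def sum_distrib_left)
  then show ?thesis using assms by linarith
qed

text \<open>\<open>S j\<close> is the estimate with \<open>X j\<close> not yet split; it starts at
  \<open>x 0\<close> and \<open>S K\<close> is the output. Passing from \<open>j\<close> to
  \<open>j + 1\<close> changes it by \<open>2 ^ j\<close> times the error of round \<open>j\<close>,
  at most \<open>round_error \<epsilon> j * S j\<close>, since \<open>2 ^ j * x j\<close> is one of
  the nonnegative summands of \<open>S j\<close>. As \<open>\<epsilon> \<le> 1\<close>, the bound
  reached so far gives \<open>S j \<le> 4 / 3 * x 0\<close>.\<close>

lemma telescoped_deviation:
  fixes x f y :: "nat \<Rightarrow> real"
  assumes \<epsilon>: "0 \<le> \<epsilon>" "\<epsilon> \<le> 1"
    and nonneg: "\<And>i. 0 \<le> x i" "\<And>i. 0 \<le> f i"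
    and split: "\<And>i. i \<le> K \<Longrightarrow> x i = f i + y i"
    and dev: "\<And>i. i < K \<Longrightarrow> \<bar>2 * x (Suc i) - y i\<bar> \<le> round_error \<epsilon> i * x i"
  shows "\<bar>(\<Sum>i\<le>K. 2 ^ i * f i) + 2 ^ K * y K - x 0\<bar> \<le> \<epsilon> / 3 * x 0"
proof -
  define S where "S j = (\<Sum>i<j. 2 ^ i * f i) + 2 ^ j * x j" for j
  have bound: "4 / 3 * x 0 * (\<Sum>i<j. round_error \<epsilon> i) \<le> \<epsilon> / 3 * x 0" for j
    using mult_right_mono[OF sum_round_error_le[OF \<epsilon>(1), of j] nonneg(1)[of 0]] by (simp add: mult_ac)
  have "j \<le> K \<Longrightarrow> \<bar>S j - x 0\<bar> \<le> 4 / 3 * x 0 * (\<Sum>i<j. round_error \<epsilon> i)" for j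
  proof (induction j)
    case 0
    show ?case by (simp add: S_def)
  next
    case (Suc j)
    have err: "0 \<le> round_error \<epsilon> j" using \<epsilon> by (simp add: round_error_def)
    have "S (Suc j) - S j = 2 ^ j * (2 * x (Suc j) - y j)"
      using split[of j] Suc by (simp add: S_def algebra_simps)
    then have "\<bar>S (Suc j) - S j\<bar> = 2 ^ j * \<bar>2 * x (Suc j) - y j\<bar>" by (simp add: abs_mult)
    also have "\<dots> \<le> 2 ^ j * (round_error \<epsilon> j * x j)" using dev[of j] Suc by (intro mult_left_mono) auto
    also have "\<dots> = round_error \<epsilon> j * (2 ^ j * x j)" by simp
    also have "\<dots> \<le> round_error \<epsilon> j * S j"
      using err nonneg by (intro mult_left_mono) (auto simp: S_def intro!: sum_nonneg)
    also have "\<dots> \<le> round_error \<epsilon> j * (4 / 3 * x 0)"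
    proof (rule mult_left_mono[OF _ err])
      have "\<epsilon> / 3 * x 0 \<le> 1 / 3 * x 0" using \<epsilon> nonneg by (intro mult_right_mono) auto
      then show "S j \<le> 4 / 3 * x 0" using Suc bound[of j] by linarith
    qed
    finally have "\<bar>S (Suc j) - S j\<bar> \<le> 4 / 3 * x 0 * round_error \<epsilon> j" by (simp add: mult_ac)
    moreover have "\<bar>S j - x 0\<bar> \<le> 4 / 3 * x 0 * (\<Sum>i<j. round_error \<epsilon> i)" using Suc by simp
    ultimately show ?case by (simp only: sum.lessThan_Suc distrib_left)
  qed
  then have "\<bar>S K - x 0\<bar> \<le> \<epsilon> / 3 * x 0" using bound[of K] by fastforce
  moreover have "S K = (\<Sum>i\<le>K. 2 ^ i * f i) + 2 ^ K * y K"
    using split[of K] by (simp add: S_def lessThan_Suc_atMost[symmetric] algebra_simps)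
  ultimately show ?thesis by simp
qed

text \<open>Loop invariant that suffices for the approximation. For \<open>i = 0\<close> the
  threshold is \<open>2 * \<rho>\<close>, the range of the initial forests. The last
  \<open>Y\<close> is not sampled yet, so accuracy is asked only of rounds with a successor.\<close>

definition good_run :: "'v set \<Rightarrow> 'v set set \<Rightarrow> real \<Rightarrow> real \<Rightarrow> 'v run \<Rightarrow> bool" where
  "good_run V E \<rho> \<epsilon> r \<longleftrightarrow> r \<noteq> [] \<and> X_of r 0 = E \<and> F_of r 0 \<noteq> {} \<and>
     (\<forall>i<length r. F_of r i \<subseteq> X_of r i \<and> Y_of r i = X_of r i - F_of r i \<and> X_of r i \<subseteq> E \<and>
        heavy V (\<rho> * 2 ^ (i + 1)) (X_of r i) (Y_of r i)) \<and>
     (\<forall>i. Suc i < length r \<longrightarrow>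
        round_ok V (round_error \<epsilon> i) (X_of r i) (Y_of r i) (X_of r (Suc i)))"

lemma run_append:
  "i < length r \<Longrightarrow> X_of (r @ [t]) i = X_of r i"
  "i < length r \<Longrightarrow> F_of (r @ [t]) i = F_of r i"
  "i < length r \<Longrightarrow> Y_of (r @ [t]) i = Y_of r i"
  "X_of (r @ [t]) (length r) = fst t"
  "F_of (r @ [t]) (length r) = fst (snd t)"
  "Y_of (r @ [t]) (length r) = snd (snd t)"
  by (simp_all add: X_of_def F_of_def Y_of_def nth_append)

lemma cut_weight_scaled:
  assumes "finite V" "\<And>e. e \<in> Z \<Longrightarrow> e \<subseteq> V \<and> card e = 2"
  shows "cut_weight V (scaled c Z) A = c * real (card (cut_edges Z A))"
proof -
  have "finite {e. e \<subseteq> V \<and> card e = 2 \<and> crosses A e}" using assms(1) by simp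
  then have "cut_weight V (scaled c Z) A = (\<Sum>e\<in>cut_edges Z A. c)"
    unfolding cut_weight_def scaled_def
    by (intro sum.mono_neutral_cong_right) (use assms(2) in \<open>auto simp: cut_edges_def\<close>)
  then show ?thesis by simp
qed

text \<open>Each cut is handled by \<open>telescoped_deviation\<close>, stopped at
  \<open>last_index r\<close>. This index may come before the end of the run; \<open>2 ^ K\<close>
  times \<open>Y K\<close> then stands in for all later rounds.\<close>

lemma good_run_cut_approx:
  assumes finV: "finite V" and E: "\<And>e. e \<in> E \<Longrightarrow> e \<subseteq> V \<and> card e = 2"
    and \<epsilon>: "0 < \<epsilon>" "\<epsilon> \<le> 1" and r: "good_run V E \<rho> \<epsilon> r"
  shows "cut_approx V (\<epsilon> / 3) (sparse_graph r) (scaled 1 E)"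
proof -
  define K where "K = last_index r"
  have "K \<in> {i. i < length r \<and> F_of r i \<noteq> {}}"
    unfolding K_def last_index_def
    by (rule Max_in) (use r in \<open>auto simp: good_run_def intro!: exI[of _ 0]\<close>)
  then have K: "K < length r" by simp
  have rounds: "F_of r i \<subseteq> X_of r i" "Y_of r i = X_of r i - F_of r i" "X_of r i \<subseteq> E" if "i \<le> K" for i
    using that K r by (auto simp: good_run_def)
  have "\<bar>cut_weight V (sparse_graph r) A - cut_weight V (scaled 1 E) A\<bar>
          \<le> \<epsilon> / 3 * cut_weight V (scaled 1 E) A" if A: "A \<subseteq> V" for A
  proof -
    define c where "c Z = real (card (cut_edges Z A))" for Z
    have "cut_weight V (sparse_graph r) A
        = (\<Sum>i\<le>K. cut_weight V (scaled (2 ^ i) (F_of r i)) A) + cut_weight V (scaled (2 ^ K) (Y_of r K)) A"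
      unfolding cut_weight_def sparse_graph_def Let_def K_def[symmetric] sum.distrib
      by (subst sum.swap) simp
    also have "\<dots> = (\<Sum>i\<le>K. 2 ^ i * c (F_of r i)) + 2 ^ K * c (Y_of r K)"
      unfolding c_def using finV E rounds
      by (intro arg_cong2[where f = "(+)"] sum.cong refl cut_weight_scaled) blast+
    finally have S: "cut_weight V (sparse_graph r) A = \<dots>" .
    have X0: "cut_weight V (scaled 1 E) A = c (X_of r 0)"
      using cut_weight_scaled[OF finV E, where c = 1 and A = A] r by (simp add: c_def good_run_def)
    show ?thesis
      unfolding S X0
    proof (rule telescoped_deviation)
      fix i assume i: "i \<le> K"
      have "finite (X_of r i)"
        using finite_edges[OF finV E] rounds[OF i] by (auto intro: finite_subset)
      moreover have "cut_edges (X_of r i) A = cut_edges (F_of r i) A \<union> cut_edges (Y_of r i) A"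
        "cut_edges (F_of r i) A \<inter> cut_edges (Y_of r i) A = {}"
        using rounds[OF i] by (auto simp: cut_edges_def)
      ultimately show "c (X_of r i) = c (F_of r i) + c (Y_of r i)"
        unfolding c_def by (metis card_Un_disjoint cut_edges_subset finite_Un finite_subset of_nat_add)
    next
      fix i assume "i < K"
      then show "\<bar>2 * c (X_of r (Suc i)) - c (Y_of r i)\<bar> \<le> round_error \<epsilon> i * c (X_of r i)"
        using r K A by (auto simp: good_run_def round_ok_def c_def)
    qed (use \<epsilon> in \<open>auto simp: c_def\<close>)
  qed
  then have dev: "\<bar>cut_weight V (sparse_graph r) A - cut_weight V (scaled 1 E) A\<bar>
          \<le> \<epsilon> / 3 * cut_weight V (scaled 1 E) A" if "A \<subset> V" for A
    using that by blast
  show ?thesis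
    unfolding cut_approx_def
  proof (intro allI impI)
    fix A assume "A \<noteq> {} \<and> A \<subset> V"
    then show "(1 - \<epsilon> / 3) * cut_weight V (scaled 1 E) A \<le> cut_weight V (sparse_graph r) A \<and>
        cut_weight V (sparse_graph r) A \<le> (1 + \<epsilon> / 3) * cut_weight V (scaled 1 E) A"
      using dev[of A] unfolding abs_le_iff left_diff_distrib distrib_right by linarith
  qed
qed

section \<open>Probability that all rounds are accurate\<close>

lemma square_less_two_power:
  assumes "n \<ge> 5"
  shows "n\<^sup>2 < (2::nat) ^ n"
  using assms
proof (induction n rule: dec_induct)
  case (step n)
  have "(Suc n)\<^sup>2 = n\<^sup>2 + 2 * n + 1" by (simp add: power2_eq_square)
  also have "\<dots> \<le> 2 * n\<^sup>2"
  proof -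
    have "2 * n + 1 \<le> 5 * n" using step by simp
    also have "\<dots> \<le> n\<^sup>2" using step by (simp add: power2_eq_square)
    finally show ?thesis by simp
  qed
  also have "\<dots> < 2 ^ Suc n" using step by simp
  finally show ?case .
qed simp

lemma prob_bind_spmf_of_pmf:
  "measure (measure_spmf (bind_spmf (spmf_of_pmf p) f)) G
     = measure_pmf.expectation p (\<lambda>x. measure (measure_spmf (f x)) G)"
  unfolding measure_spmf_bind measure_spmf_spmf_of_pmf o_def
  by (rule measure_pmf.measure_bind[where N = "count_space UNIV"]) simp_all

text \<open>Induction on a bound for the number of rounds still to come, each failing with
  probability at most \<open>2 / n ^ 2\<close>. A good run has at most \<open>n + 1\<close> rounds,
  so good branches lose no mass to nontermination.\<close>

lemma sampling_loop_good:
  fixes V :: "'v set"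
  defines "n \<equiv> card V"
  assumes finV: "finite V" and E: "\<And>e. e \<in> E \<Longrightarrow> e \<subseteq> V \<and> card e = 2"
    and NI: "NI_procedure NI" and \<epsilon>: "0 < \<epsilon>" and \<rho>: "\<rho> \<ge> 1" and n: "n \<ge> 256"
    and err: "\<And>i. (round_error \<epsilon> i)\<^sup>2 * (\<rho> * 2 ^ (i + 1)) \<ge> 27 * ln (real n)"
    and r: "good_run V E \<rho> \<epsilon> r"
  shows "measure (measure_spmf (sampling_loop NI V \<rho> r)) {r. good_run V E \<rho> \<epsilon> r}
           \<ge> 1 - real (n + 1 - length r) * (2 / (real n)\<^sup>2)"
proof -
  define \<eta> where "\<eta> = 2 / (real n)\<^sup>2"
  have stop: "sampling_loop NI V \<rho> r = return_spmf r"
    if "real (card (Y_of r (length r - 1))) \<le> 2 * \<rho> * real (card V)" for r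
    using that by (subst sampling_loop.simps) simp
  have stop_prob: "1 - real (n + 1 - length r) * (2 / (real n)\<^sup>2)
      \<le> measure (measure_spmf (sampling_loop NI V \<rho> r)) {r. good_run V E \<rho> \<epsilon> r}"
    if "real (card (Y_of r (length r - 1))) \<le> 2 * \<rho> * real (card V)" "good_run V E \<rho> \<epsilon> r" for r
  proof -
    have "measure (measure_spmf (sampling_loop NI V \<rho> r)) {r. good_run V E \<rho> \<epsilon> r} = 1"
      unfolding stop[OF that(1)] using that(2) by (simp add: measure_spmf_return_spmf measure_return)
    then show ?thesis by simp
  qed
  \<comment> \<open>The cut around one end of an edge of the last \<open>Y\<close> has at least
    \<open>\<rho> * 2 ^ length r\<close> edges, whereas \<open>E\<close> has at most
    \<open>n ^ 2 < 2 ^ n\<close>.\<close>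
  have rounds_bound: "length r \<le> n"
    if r: "good_run V E \<rho> \<epsilon> r" and Y: "Y_of r (length r - 1) \<noteq> {}" for r
  proof -
    define i where "i = length r - 1"
    have i: "i < length r" "length r = Suc i" using r by (auto simp: i_def good_run_def)
    have good: "Y_of r i \<subseteq> X_of r i" "X_of r i \<subseteq> E" "heavy V (\<rho> * 2 ^ (i + 1)) (X_of r i) (Y_of r i)"
      using r i by (auto simp: good_run_def)
    obtain e where e: "e \<in> Y_of r i" using Y by (auto simp: i_def)
    then have "card e = 2" "e \<subseteq> V" using good E by blast+
    then obtain u v where uv: "e = {u, v}" "u \<noteq> v" by (auto simp: card_2_iff)
    then have "crosses {u} e" "{u} \<subseteq> V" using \<open>e \<subseteq> V\<close> by (auto simp: crosses_pair)
    then have "\<rho> * 2 ^ (i + 1) \<le> real (card (cut_edges (X_of r i) {u}))"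
      using good(3) e by (auto simp: heavy_def)
    also have "card (cut_edges (X_of r i) {u}) \<le> card E"
      using finite_edges[OF finV E] good(2) cut_edges_subset by (intro card_mono) (blast | simp)+
    also have "card E \<le> n\<^sup>2" unfolding n_def by (rule card_edges_le[OF finV E])
    finally have "\<rho> * 2 ^ (i + 1) \<le> real (n\<^sup>2)" by simp
    moreover have "2 ^ (i + 1) \<le> \<rho> * 2 ^ (i + 1)" using \<rho> by simp
    ultimately have "2 ^ (i + 1) \<le> real (n\<^sup>2)" by (rule order_trans[rotated])
    then have "real (2 ^ length r) \<le> real (n\<^sup>2)" using i by simp
    then have "2 ^ length r \<le> n\<^sup>2" by (simp only: of_nat_le_iff)
    then have "2 ^ length r < (2 :: nat) ^ n"
      using square_less_two_power[of n] n by linarith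
    then show ?thesis by simp
  qed
  \<comment> \<open>The sample \<open>Z\<close> is drawn from round \<open>length r - 1\<close>,
    whose error bound applies; the new round has index \<open>length r\<close>, which matches the
    threshold in \<open>next_round\<close>.\<close>
  have extend: "good_run V E \<rho> \<epsilon> (r @ [next_round NI V \<rho> (length r) Z])"
    if r: "good_run V E \<rho> \<epsilon> r" and Z: "Z \<subseteq> Y_of r (length r - 1)"
      and ok: "round_ok V (round_error \<epsilon> (length r - 1)) (X_of r (length r - 1)) (Y_of r (length r - 1)) Z" for r Z
  proof -
    let ?r = "r @ [next_round NI V \<rho> (length r) Z]"
    have len: "0 < length r" using r by (simp add: good_run_def)
    then have "length r - 1 < length r" by simp
    then have ZE: "Z \<subseteq> E" using r Z unfolding good_run_def by blast
    define k where "k = \<rho> * 2 ^ (length r + 1)"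
    have "k \<ge> 0" using \<rho> by (simp add: k_def)
    have "e \<subseteq> V \<and> card e = 2" if "e \<in> Z" for e using that E ZE by blast
    note heavy = contract_heavy_heavy[OF finV this \<open>k \<ge> 0\<close> NI]
    have next_round: "next_round NI V \<rho> (length r) Z
        = (Z, medges (contract_heavy NI V k Z), Z - medges (contract_heavy NI V k Z))"
      by (simp add: next_round_def k_def Let_def)
    show ?thesis
      unfolding good_run_def
    proof (intro conjI allI impI)
      fix i
      assume "i < length ?r"
      then consider "i < length r" | "i = length r" by fastforce
      then have "F_of ?r i \<subseteq> X_of ?r i \<and>
        Y_of ?r i = X_of ?r i - F_of ?r i \<and>
        X_of ?r i \<subseteq> E \<and>
        heavy V (\<rho> * 2 ^ (i + 1)) (X_of ?r i) (Y_of ?r i)"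
      proof cases
        case 1
        show ?thesis using r 1 unfolding good_run_def run_append(1-3)[OF 1] by blast
      next
        case 2
        then show ?thesis using heavy ZE by (simp add: run_append next_round k_def)
      qed
      then show "F_of ?r i \<subseteq> X_of ?r i"
        and "Y_of ?r i = X_of ?r i - F_of ?r i"
        and "X_of ?r i \<subseteq> E"
        and "heavy V (\<rho> * 2 ^ (i + 1)) (X_of ?r i) (Y_of ?r i)"
        by blast+
    next
      fix i
      assume "Suc i < length ?r"
      then consider "Suc i < length r" | "i = length r - 1" "Suc i = length r" by fastforce
      then show "round_ok V (round_error \<epsilon> i) (X_of ?r i)
          (Y_of ?r i) (X_of ?r (Suc i))"
      proof cases
        case 1
        then have "i < length r" by simp
        with 1 show ?thesis
          using r unfolding good_run_def run_append(1-3)[OF \<open>i < length r\<close>] run_append(1)[OF 1] by blast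
      next
        case 2
        then have "X_of ?r (Suc i) = Z" "i < length r"
          by (simp_all add: run_append next_round)
        then show ?thesis using ok 2(1) by (simp add: run_append)
      qed
    qed (use r len in \<open>simp_all add: run_append good_run_def\<close>)
  qed
  show ?thesis
    using r
  proof (induction "n + 1 - length r" arbitrary: r)
    case (0 r)
    have "Y_of r (length r - 1) = {}" using rounds_bound[OF 0(2)] 0(1) by fastforce
    then have "real (card (Y_of r (length r - 1))) \<le> 2 * \<rho> * real (card V)" using \<rho> by simp
    then show ?case using 0(2) by (rule stop_prob)
  next
    case (Suc j r)
    show ?case
    proof (cases "real (card (Y_of r (length r - 1))) \<le> 2 * \<rho> * real (card V)")
      case True
      then show ?thesis using Suc(3) by (rule stop_prob)
    next
      case False
      define i where "i = length r - 1"
      have i: "i < length r" "length r = Suc i" using Suc(3) by (auto simp: i_def good_run_def)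
      let ?Y = "Y_of r i" and ?X = "X_of r i"
      have good: "?Y = ?X - F_of r i" "?X \<subseteq> E" "heavy V (\<rho> * 2 ^ (i + 1)) ?X ?Y"
        using Suc(3) i by (auto simp: good_run_def)
      let ?ok = "{Z. round_ok V (round_error \<epsilon> i) ?X ?Y Z}"
      let ?f = "\<lambda>Z. r @ [next_round NI V \<rho> (length r) Z]"
      let ?P = "\<lambda>r. measure (measure_spmf (sampling_loop NI V \<rho> r)) {r. good_run V E \<rho> \<epsilon> r}"
      have step: "sampling_loop NI V \<rho> r
          = bind_spmf (spmf_of_pmf (sample_half ?Y)) (\<lambda>Z. sampling_loop NI V \<rho> (?f Z))"
        using False by (subst sampling_loop.simps) (simp add: i_def)
      have exp: "?P r = measure_pmf.expectation (sample_half ?Y) (\<lambda>Z. ?P (?f Z))"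
        unfolding step by (rule prob_bind_spmf_of_pmf)
      have int_ok: "integrable (measure_pmf (sample_half ?Y)) (indicator ?ok :: _ \<Rightarrow> real)"
        by (rule measure_pmf.integrable_const_bound[where B = 1]) auto
      \<comment> \<open>After an accurate sample the induction hypothesis gives
        \<open>1 - j * \<eta>\<close>; otherwise the claimed lower bound is at most 0.\<close>
      have mono: "measure_pmf.expectation (sample_half ?Y) (\<lambda>Z. indicator ?ok Z - real j * \<eta>)
          \<le> measure_pmf.expectation (sample_half ?Y) (\<lambda>Z. ?P (?f Z))"
      proof (rule integral_mono_AE)
        have "indicator ?ok Z - real j * \<eta> \<le> ?P (?f Z)" if Z: "Z \<subseteq> ?Y" for Z
        proof (cases "Z \<in> ?ok")
          case True
          then have "good_run V E \<rho> \<epsilon> (?f Z)" using extend[OF Suc(3), of Z, folded i_def] Z by simp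
          then have "1 - real (n + 1 - length (?f Z)) * \<eta> \<le> ?P (?f Z)"
            using Suc(1)[of "?f Z"] Suc(2) by (simp add: \<eta>_def)
          moreover have "n + 1 - length (?f Z) = j" using Suc(2) by simp
          ultimately show ?thesis using True by simp
        next
          case False
          then have "indicator ?ok Z - real j * \<eta> \<le> 0" by (simp add: \<eta>_def)
          then show ?thesis using measure_nonneg order_trans by blast
        qed
        then show "AE Z in measure_pmf (sample_half ?Y). indicator ?ok Z - real j * \<eta> \<le> ?P (?f Z)"
          using set_pmf_sample_half by (auto simp: AE_measure_pmf_iff)
        show "integrable (measure_pmf (sample_half ?Y)) (\<lambda>Z. ?P (?f Z))"
          by (rule measure_pmf.integrable_const_bound[where B = 1])
            (auto simp: measure_spmf.subprob_measure_le_1)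
      qed (use int_ok in \<open>auto intro!: Bochner_Integration.integrable_diff\<close>)
      have expand: "measure_pmf.expectation (sample_half ?Y) (\<lambda>Z. indicator ?ok Z - real j * \<eta>)
          = measure_pmf.prob (sample_half ?Y) ?ok - real j * \<eta>"
        using int_ok by (subst Bochner_Integration.integral_diff) auto
      have compl: "measure_pmf.prob (sample_half ?Y) ?ok
          = 1 - measure_pmf.prob (sample_half ?Y) {Z. \<not> round_ok V (round_error \<epsilon> i) ?X ?Y Z}"
        using measure_pmf.prob_compl[of ?ok "sample_half ?Y"] by (simp add: Compl_eq_Diff_UNIV[symmetric] Collect_neg_eq)
      have "measure_pmf.prob (sample_half ?Y) {Z. \<not> round_ok V (round_error \<epsilon> i) ?X ?Y Z} \<le> \<eta>"
        unfolding \<eta>_def n_def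
      proof (rule round_failure_prob[OF finV _ _ good(3)])
        show "e \<subseteq> V \<and> card e = 2" if "e \<in> ?X" for e using E good(2) that by blast
        show "?Y \<subseteq> ?X" using good(1) by blast
        show "(round_error \<epsilon> i)\<^sup>2 * (\<rho> * 2 ^ (i + 1)) \<ge> 27 * ln (real (card V))"
          using err n_def by simp
      qed (use \<rho> n \<epsilon> n_def in \<open>auto simp: round_error_def\<close>)
      then have "1 - \<eta> - real j * \<eta> \<le> ?P r"
        using exp mono expand compl by linarith
      moreover have "real (n + 1 - length r) * (2 / (real n)\<^sup>2) = \<eta> + real j * \<eta>"
        unfolding Suc(2)[symmetric] by (simp add: \<eta>_def algebra_simps add_divide_distrib)
      ultimately show ?thesis by simp
    qed
  qed
qed

theorem mainTheorem2:
  fixes V :: "'v set" and E :: "'v set set" and n m :: nat and \<epsilon> \<rho> :: real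
    and NI :: "'v NI_procedure"
  assumes "simple_graph V E"
    and "n = card V" and "m = card E"
    and "0 < \<epsilon>" and "\<epsilon> \<le> 1"
    and "\<rho> = rho n \<epsilon>"
    and "real m > 2 * \<rho> * real n"
    and "NI_procedure NI"
  shows "measure (measure_spmf (sampling_algorithm NI V E \<rho>))
           {r. cut_approx V (\<epsilon> / 3) (sparse_graph r) (scaled 1 E)} \<ge> 1 - 4 / real n"
proof -
  have finV: "finite V" and E: "\<And>e. e \<in> E \<Longrightarrow> e \<subseteq> V \<and> card e = 2"
    using assms(1) by (auto simp: simple_graph_def)
  have mn: "m \<le> n\<^sup>2" unfolding assms(2,3) by (rule card_edges_le[OF finV E])
  \<comment> \<open>For \<open>n \<le> 1\<close> there are no edges, while
    \<open>2 * \<rho> * n\<close> is 0 because \<open>ln 1 = 0\<close>.\<close>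
  have "n \<noteq> 0 \<and> n \<noteq> 1"
  proof (intro conjI notI)
    assume "n = 0"
    then show False using mn assms(7) by simp
  next
    assume n1: "n = 1"
    have "e \<notin> E" for e
    proof
      assume e: "e \<in> E"
      then have "card e \<le> card V" using finV E by (intro card_mono) auto
      then show False using E[OF e] n1 assms(2) by simp
    qed
    then have "E = {}" by blast
    then show False using assms(3,6,7) n1 by (simp add: rho_def)
  qed
  then have n2: "n \<ge> 2" by simp
  have ln2: "ln (real n) \<ge> 1 / 2"
  proof -
    have "1 / 2 \<le> ln (2 :: real)" using ln2_ge_two_thirds by simp
    also have "\<dots> \<le> ln (real n)" using n2 by simp
    finally show ?thesis .
  qed
  have \<rho>_ge: "\<rho> \<ge> 1014 / 0.38 * ln (real n)"
  proof -
    have "\<epsilon>\<^sup>2 \<le> 1" using assms(4,5) by (simp add: power_le_one)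
    then have "1014 * ln (real n) / 0.38 \<le> 1014 * ln (real n) / (0.38 * \<epsilon>\<^sup>2)"
      using assms(4) ln2 by (intro divide_left_mono) auto
    then show ?thesis by (simp add: assms(6) rho_def)
  qed
  then have \<rho>: "\<rho> \<ge> 1000" using ln2 by simp
  \<comment> \<open>From \<open>2 * \<rho> * n < m \<le> n ^ 2\<close> follows
    \<open>n > 2 * \<rho>\<close>, far above the 256 needed for the counting bound.\<close>
  have "real n * real n \<ge> real m" using mn by (metis of_nat_le_iff of_nat_mult power2_eq_square)
  then have "2 * \<rho> * real n < real n * real n" using assms(7) by linarith
  then have "2 * \<rho> < real n" using n2 by simp
  then have n: "n \<ge> 256" using \<rho> by simp
  have err: "(round_error \<epsilon> i)\<^sup>2 * (\<rho> * 2 ^ (i + 1)) \<ge> 27 * ln (real n)" for i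
  proof -
    have sq: "((71 / 100 :: real) ^ i)\<^sup>2 = ((71 / 100)\<^sup>2) ^ i"
      by (simp only: power_mult[symmetric] mult.commute)
    \<comment> \<open>\<open>37.24 = 98 * 0.38\<close>, where \<open>98 = 14 ^ 2 / 2\<close> comes
      from the prefactor \<open>\<epsilon> / 14\<close> and the factor 2 in the threshold of round
      0; \<open>1014 / 37.24\<close> is just above 27. Each further round multiplies by
      \<open>(71 / 100) ^ 2 * 2 > 1\<close>.\<close>
    have "27 * ln (real n) \<le> 1014 / 37.24 * ln (real n)" using ln2 by simp
    also have "\<dots> = \<epsilon>\<^sup>2 * \<rho> / 98 * 1"
      using assms(4) by (simp add: assms(6) rho_def)
    also have "\<dots> \<le> \<epsilon>\<^sup>2 * \<rho> / 98 * ((71 / 100)\<^sup>2 * 2) ^ i"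
      using \<rho> by (intro mult_left_mono one_le_power) (auto simp: power2_eq_square)
    also have "\<dots> = (\<epsilon> / 14)\<^sup>2 * ((71 / 100)\<^sup>2) ^ i * (\<rho> * 2 ^ (i + 1))"
      unfolding power_mult_distrib[of _ 2] by (simp add: power_divide)
    also have "\<dots> = (round_error \<epsilon> i)\<^sup>2 * (\<rho> * 2 ^ (i + 1))"
      by (simp only: round_error_def power_mult_distrib sq)
    finally show ?thesis .
  qed
  let ?r = "[initial_round NI V E \<rho>]"
  have r: "good_run V E \<rho> \<epsilon> ?r"
  proof -
    have "0 \<le> 2 * \<rho> * real n" using \<rho> by simp
    then have "E \<noteq> {}" using assms(3,7) by auto
    moreover have "2 * \<rho> \<ge> 0" "2 * \<rho> \<ge> 1" using \<rho> by auto
    ultimately show ?thesis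
      using initial_round_heavy[OF finV E assms(8), where k = "2 * \<rho>"]
      by (simp add: good_run_def initial_round_def Let_def X_of_def F_of_def Y_of_def mult.commute)
  qed
  \<comment> \<open>At most \<open>n\<close> rounds follow the initial one, so the total failure
    probability is at most \<open>2 / n\<close>.\<close>
  have "1 - 4 / real n \<le> 1 - real (n + 1 - length ?r) * (2 / (real n)\<^sup>2)"
    using n by (simp add: field_simps power2_eq_square)
  also have "\<dots> \<le> measure (measure_spmf (sampling_algorithm NI V E \<rho>)) {r. good_run V E \<rho> \<epsilon> r}"
    unfolding sampling_algorithm_def assms(2)
    by (rule sampling_loop_good[OF finV E assms(8,4) _ _ _ r])
      (use \<rho> n err assms(2) in auto)
  also have "\<dots> \<le> measure (measure_spmf (sampling_algorithm NI V E \<rho>))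
      {r. cut_approx V (\<epsilon> / 3) (sparse_graph r) (scaled 1 E)}"
    using good_run_cut_approx[OF finV E assms(4,5)]
    by (intro measure_spmf.finite_measure_mono) auto
  finally show ?thesis .
qed

end
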